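(* Let $K$ be an uncountable algebraically closed inversive difference field and let $F\subseteq K\{x_1,\ldots,x_n\}$ be a finite set. The following statements are equivalent: 1. $F$ has a solution in $K^{\mathbb{Z}}$. 2. $F$ has a solution in $K^{\mathbb{N}}$. 3. $F$ has finite partial solutions of length $\ell$ for all $\ell\gg0$. 4. The ideal $[F]:=\langle\{\sigma^j(F)\mid j\in\mathbb{N}\}\rangle\subseteq K\{x_1,\ldots,x_n\}$ does not contain $1$. 5. The ideal $[F]^*:=\langle\{\sigma^j(F)\mid j\in\mathbb{Z}\}\rangle\subseteq K\{x_1,\ldots,x_n\}^*$ does not contain $1$. 6. $F$ has a solution in some difference $K$-algebra.
   Context: A difference ring is a pair $(A,\sigma)$ with $A$ a commutative ring and $\sigma:A\to A$ a ring endomorphism; it is inversive if $\sigma$ is an automorphism. A difference field is a difference ring that is a field. $K\{x_1,\ldots,x_n\}$ is the polynomial ring over $K$ in the indeterminates $\sigma^j(x_i)$, $j\in\mathbb{N}$ ($0\in\mathbb{N}$), and $K\{x_1,\ldots,x_n\}^*$ is the polynomial ring over $K$ in the indeterminates $\sigma^j(x_i)$, $j\in\mathbb{Z}$; in both, $\sigma$ extends $\sigma$ on $K$ by $\sigma(\sigma^j(x_i))=\sigma^{j+1}(x_i)$. $\sigma^j(F)=\{\sigma^j(f)\mid f\in F\}$, and $\langle\cdot\rangle$ denotes the ordinary ideal generated. $K^{\mathbb{Z}}$ and $K^{\mathbb{N}}$ are difference rings under the shift $\sigma((a_i)_i)=(a_{i+1})_i$, and are difference $K$-algebras via $f\mapsto(\sigma^i(f))_{i\in\mathbb{Z}}$,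 respectively $f\mapsto(\sigma^i(f))_{i\in\mathbb{N}}$. A difference $K$-algebra means a difference ring extension $B$ of $(K,\sigma)$ (in particular $B\ne0$). A tuple $(b_1,\ldots,b_n)\in B^n$ is a solution of $F$ if every element of $F$ maps to $0$ under the unique map of difference rings $K\{x_1,\ldots,x_n\}\to B$ extending $K\to B$ with $x_i\mapsto b_i$. Partial solutions: let $h$ be the maximum of the orders of the elements of $F$ (the order of $f$ is the largest $j$ such that some $\sigma^j(x_i)$ appears in $f$). A partial solution of length $\ell$ is an $n$-tuple of vectors $\mathbf{a}_j=(a_{j,0},\ldots,a_{j,\ell+h-1})\in K^{\ell+h}$, $1\le j\le n$, such that for every $f\in F$ and $0\le s\le\ell-1$ the polynomial $\sigma^s(f)$ vanishes under the substitution $\sigma^i(x_j)=a_{j,i}$ ($1\le j\le n$, $0\le i\le\ell+h-1$). *)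

theory Defs
  imports
    "HOL-Library.Poly_Mapping"
    "HOL-Library.Countable_Set"
    "HOL-Algebra.Algebraic_Closure_Type"
begin

section \<open>Difference rings\<close>

definition difference_ring :: "('a, 'm) ring_scheme \<Rightarrow> ('a \<Rightarrow> 'a) \<Rightarrow> bool" where
  "difference_ring R s \<longleftrightarrow> cring R \<and> s \<in> ring_hom R R"

definition inversive_difference_ring :: "('a, 'm) ring_scheme \<Rightarrow> ('a \<Rightarrow> 'a) \<Rightarrow> bool" where
  "inversive_difference_ring R s \<longleftrightarrow> difference_ring R s \<and> bij_betw s (carrier R) (carrier R)"

definition inversive_difference_field :: "('a, 'm) ring_scheme \<Rightarrow> ('a \<Rightarrow> 'a) \<Rightarrow> bool" where
  "inversive_difference_field R s \<longleftrightarrow> inversive_difference_ring R s \<and> field R"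

text \<open>A difference ring extension, with the inclusion given as an injective structure map
  \<open>\<iota>\<close>; over a field, injectivity amounts to \<open>B\<close> being nonzero.\<close>

definition difference_algebra ::
    "('k, 'm) ring_scheme \<Rightarrow> ('k \<Rightarrow> 'k) \<Rightarrow> ('b, 'n) ring_scheme \<Rightarrow> ('b \<Rightarrow> 'b) \<Rightarrow> ('k \<Rightarrow> 'b) \<Rightarrow> bool" where
  "difference_algebra K \<sigma> B s \<iota> \<longleftrightarrow>
     difference_ring B s \<and> \<iota> \<in> ring_hom K B \<and> inj_on \<iota> (carrier K) \<and>
     (\<forall>c\<in>carrier K. \<iota> (\<sigma> c) = s (\<iota> c))"

text \<open>Integer iterates of a bijection. The inverse is written \<open>inv_into UNIV\<close> because
  \<open>inv\<close> denotes inversion in a monoid in HOL-Algebra.\<close>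

definition int_funpow :: "('a \<Rightarrow> 'a) \<Rightarrow> int \<Rightarrow> 'a \<Rightarrow> 'a" where
  "int_funpow f j = (if 0 \<le> j then f ^^ nat j else inv_into UNIV f ^^ nat (- j))"


section \<open>Difference polynomials\<close>

text \<open>The indeterminate \<open>\<sigma>\<^sup>j(x\<^sub>i)\<close> is the pair \<open>(i, j)\<close>; monomials are finitely supported exponent
  functions and polynomials are finitely supported coefficient functions on monomials, with the
  convolution product of the library. With \<open>'j = nat\<close> this is \<open>K{x\<^sub>1,\<dots>,x\<^sub>n}\<close>, with \<open>'j = int\<close> it is
  \<open>K{x\<^sub>1,\<dots>,x\<^sub>n}\<^sup>*\<close>, where \<open>n = CARD('n)\<close>.\<close>

type_synonym ('n, 'j, 'k) dpoly = "('n \<times> 'j \<Rightarrow>\<^sub>0 nat) \<Rightarrow>\<^sub>0 'k"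

definition dconst :: "'k::zero \<Rightarrow> ('n, 'j, 'k) dpoly" where
  "dconst c = Poly_Mapping.single 0 c"

definition dvar :: "'n \<Rightarrow> 'j \<Rightarrow> ('n, 'j, 'k::zero_neq_one) dpoly" where
  "dvar i j = Poly_Mapping.single (Poly_Mapping.single (i, j) 1) 1"

text \<open>Rename each indeterminate \<open>v\<close> to \<open>g v\<close> and apply \<open>s\<close> to the coefficients.\<close>

definition dpoly_map ::
    "('n \<times> 'i \<Rightarrow> 'n \<times> 'j) \<Rightarrow> ('k \<Rightarrow> 'k) \<Rightarrow> ('n, 'i, 'k::comm_monoid_add) dpoly \<Rightarrow> ('n, 'j, 'k) dpoly" where
  "dpoly_map g s p =
     (\<Sum>m\<in>Poly_Mapping.keys p.
        Poly_Mapping.single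
          (\<Sum>v\<in>Poly_Mapping.keys m. Poly_Mapping.single (g v) (Poly_Mapping.lookup m v))
          (s (Poly_Mapping.lookup p m)))"

definition dshift ::
    "('k \<Rightarrow> 'k) \<Rightarrow> ('n, 'j::{plus,one}, 'k::comm_monoid_add) dpoly \<Rightarrow> ('n, 'j, 'k) dpoly" where
  "dshift \<sigma> = dpoly_map (\<lambda>(i, j). (i, j + 1)) \<sigma>"

definition dembed :: "('n, nat, 'k::comm_monoid_add) dpoly \<Rightarrow> ('n, int, 'k) dpoly" where
  "dembed = dpoly_map (\<lambda>(i, j). (i, int j)) (\<lambda>c. c)"

definition diff_ideal ::
    "('k \<Rightarrow> 'k) \<Rightarrow> ('n, nat, 'k::comm_ring_1) dpoly set \<Rightarrow> ('n, nat, 'k) dpoly set" where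
  "diff_ideal \<sigma> F = Idl\<^bsub>ring_of_type_algebra\<^esub> (\<Union>j::nat. (dshift \<sigma> ^^ j) ` F)"

definition diff_ideal_star ::
    "('k \<Rightarrow> 'k) \<Rightarrow> ('n, nat, 'k::comm_ring_1) dpoly set \<Rightarrow> ('n, int, 'k) dpoly set" where
  "diff_ideal_star \<sigma> F =
     Idl\<^bsub>ring_of_type_algebra\<^esub> (\<Union>j::int. int_funpow (dshift \<sigma>) j ` (dembed ` F))"


section \<open>Solutions\<close>

text \<open>The map \<open>\<phi>\<close> is uniquely determined by \<open>b\<close>.\<close>

definition is_solution ::
    "('k \<Rightarrow> 'k) \<Rightarrow> ('b, 'm) ring_scheme \<Rightarrow> ('b \<Rightarrow> 'b) \<Rightarrow> ('k \<Rightarrow> 'b) \<Rightarrow>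
     ('n, nat, 'k::comm_ring_1) dpoly set \<Rightarrow> ('n \<Rightarrow> 'b) \<Rightarrow> bool" where
  "is_solution \<sigma> B s \<iota> F b \<longleftrightarrow>
     (\<forall>i. b i \<in> carrier B) \<and>
     (\<exists>\<phi> \<in> ring_hom (ring_of_type_algebra :: ('n, nat, 'k) dpoly ring) B.
        (\<forall>p. \<phi> (dshift \<sigma> p) = s (\<phi> p)) \<and>
        (\<forall>c. \<phi> (dconst c) = \<iota> c) \<and>
        (\<forall>i. \<phi> (dvar i 0) = b i) \<and>
        (\<forall>f\<in>F. \<phi> f = \<zero>\<^bsub>B\<^esub>))"

text \<open>\<open>K\<^sup>\<nat>\<close> and \<open>K\<^sup>\<int>\<close>.\<close>

definition seq_ring :: "('j \<Rightarrow> 'k::comm_ring_1) ring" where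
  "seq_ring = \<lparr>carrier = UNIV, monoid.mult = (\<lambda>a b i. a i * b i), one = (\<lambda>_. 1),
               ring.zero = (\<lambda>_. 0), ring.add = (\<lambda>a b i. a i + b i)\<rparr>"

definition seq_shift :: "('j::{plus,one} \<Rightarrow> 'k) \<Rightarrow> ('j \<Rightarrow> 'k)" where
  "seq_shift a = (\<lambda>i. a (i + 1))"

definition solvable_in_Z_sequences ::
    "('k \<Rightarrow> 'k) \<Rightarrow> ('n, nat, 'k::comm_ring_1) dpoly set \<Rightarrow> bool" where
  "solvable_in_Z_sequences \<sigma> F \<longleftrightarrow>
     (\<exists>b. is_solution \<sigma> (seq_ring :: (int \<Rightarrow> 'k) ring) seq_shift (\<lambda>c i. int_funpow \<sigma> i c) F b)"

definition solvable_in_N_sequences ::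
    "('k \<Rightarrow> 'k) \<Rightarrow> ('n, nat, 'k::comm_ring_1) dpoly set \<Rightarrow> bool" where
  "solvable_in_N_sequences \<sigma> F \<longleftrightarrow>
     (\<exists>b. is_solution \<sigma> (seq_ring :: (nat \<Rightarrow> 'k) ring) seq_shift (\<lambda>c i. (\<sigma> ^^ i) c) F b)"

text \<open>HOL cannot quantify over types inside a formula, so solvability in some difference
  \<open>K\<close>-algebra is relative to a type \<open>'b\<close> containing the carrier. For \<open>'b = ('n, nat, 'k) dpoly set\<close>
  nothing is lost: the difference subalgebra generated by a solution is a quotient of
  \<open>K{x\<^sub>1,\<dots>,x\<^sub>n}\<close>, hence has a copy whose elements are cosets in the polynomial ring.\<close>

definition solvable_in_algebra ::
    "'b itself \<Rightarrow> ('k \<Rightarrow> 'k) \<Rightarrow> ('n, nat, 'k::comm_ring_1) dpoly set \<Rightarrow> bool" where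
  "solvable_in_algebra _ \<sigma> F \<longleftrightarrow>
     (\<exists>(B :: 'b ring) s \<iota> b.
        difference_algebra (ring_of_type_algebra :: 'k ring) \<sigma> B s \<iota> \<and> is_solution \<sigma> B s \<iota> F b)"


section \<open>Partial solutions\<close>

text \<open>Inserting \<open>0\<close> fixes the order of a constant polynomial, and the maximal order of the empty
  system, to be \<open>0\<close>.\<close>

definition dorder :: "('n, nat, 'k::zero) dpoly \<Rightarrow> nat" where
  "dorder f = Max (insert 0 {j. \<exists>i. \<exists>m\<in>Poly_Mapping.keys f. (i, j) \<in> Poly_Mapping.keys m})"

definition max_order :: "('n, nat, 'k::zero) dpoly set \<Rightarrow> nat" where
  "max_order F = Max (insert 0 (dorder ` F))"

definition dsubst :: "('n \<times> 'j \<Rightarrow> 'k) \<Rightarrow> ('n, 'j, 'k::comm_semiring_1) dpoly \<Rightarrow> 'k" where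
  "dsubst \<alpha> p =
     (\<Sum>m\<in>Poly_Mapping.keys p.
        Poly_Mapping.lookup p m * (\<Prod>v\<in>Poly_Mapping.keys m. \<alpha> v ^ Poly_Mapping.lookup m v))"

text \<open>Only indeterminates of order at most \<open>l + max_order F - 1\<close> occur in the polynomials evaluated
  here, so list access is always within bounds.\<close>

definition is_partial_solution ::
    "('k \<Rightarrow> 'k) \<Rightarrow> ('n, nat, 'k::comm_ring_1) dpoly set \<Rightarrow> nat \<Rightarrow> ('n \<Rightarrow> 'k list) \<Rightarrow> bool" where
  "is_partial_solution \<sigma> F l a \<longleftrightarrow>
     (\<forall>j. length (a j) = l + max_order F) \<and>
     (\<forall>f\<in>F. \<forall>s<l. dsubst (\<lambda>(j, i). a j ! i) ((dshift \<sigma> ^^ s) f) = 0)"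

end

theory Submission
  imports Defs
begin

text \<open>
  The conditions are tied together by a cycle of implications, with solvability in an algebra
  attached as a side loop at the properness of \<open>[F]\<close>.

  The substantial step is from a proper ideal \<open>[F]\<^sup>*\<close> to a solution in \<open>K\<^sup>\<int>\<close>. A solution in \<open>K\<^sup>\<int>\<close> is the
  same as a common zero of \<open>[F]\<^sup>*\<close> in the affine space whose coordinates are the countably many
  indeterminates \<open>\<sigma>\<^sup>j(x\<^sub>i)\<close>: entry \<open>k\<close> of the image of a polynomial is the value of its \<open>k\<close>-th shift.
  A proper ideal in countably many variables over an uncountable algebraically closed field has
  a zero (\<open>countable_nullstellensatz\<close>). Indeed, modulo a maximal ideal \<open>M\<close> the polynomial ring is a
  field extension of \<open>K\<close> of countable dimension; an element \<open>x\<close> of it outside \<open>K\<close> would be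
  transcendental and would give uncountably many linearly independent elements \<open>1/(x - c)\<close>.
  So every variable is congruent to a constant modulo \<open>M\<close>, and these constants form a zero.

  Restricting sequences to \<open>\<nat>\<close> and truncating them gives partial solutions. That partial solutions
  of all large lengths force \<open>[F]\<close> to be proper (\<open>proper_diff_ideal_of_partial_solutions\<close>), and that
  \<open>[F]\<^sup>*\<close> is proper if \<open>[F]\<close> is (\<open>proper_diff_ideal_star_of_proper_diff_ideal\<close>), are finiteness
  statements: an expression of \<open>1\<close> as a combination of generators involves only finitely many shifts
  and indeterminates. Both are proved without writing out such expressions, by
  exhibiting an ideal, described by a condition that holds eventually, which contains all generators.

  For solvability in an algebra, the quotient \<open>K{x\<^sub>1,\<dots>,x\<^sub>n}/[F]\<close> is a generic solution if \<open>[F]\<close> is proper;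
  its elements are cosets, so it lives on a type of sets of difference polynomials. Conversely the
  kernel of the evaluation map at any solution, over whatever type, is a shift-stable ideal that
  contains \<open>F\<close> but not \<open>1\<close>.
\<close>

section \<open>Ideals and ring maps of type-class rings\<close>

text \<open>Over itself, a commutative ring is a module whose submodules are the ideals, so the calculus of
  submodules applies to ideals.\<close>
interpretation mult_module: Modules.module "(*) :: 'a::comm_ring_1 \<Rightarrow> 'a \<Rightarrow> 'a"
  by standard (auto simp: algebra_simps)

(* As a rewrite rule this is associativity from right to left, which loops against mult.assoc. *)
declare mult_module.scale_scale [simp del]

abbreviation ring_ideal :: "'a::comm_ring_1 set \<Rightarrow> bool" where
  "ring_ideal \<equiv> mult_module.subspace"

lemma ideal_ring_of_type_algebra_iff:
  "ideal I (ring_of_type_algebra :: 'a::comm_ring_1 ring) \<longleftrightarrow> ring_ideal I"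
proof
  assume "ideal I (ring_of_type_algebra :: 'a ring)"
  then interpret ideal I "ring_of_type_algebra :: 'a ring" .
  show "ring_ideal I"
    using additive_subgroup.a_closed[OF is_additive_subgroup]
      additive_subgroup.zero_closed[OF is_additive_subgroup] I_l_closed
    by (auto simp: mult_module.subspace_def ring_of_type_algebra_def)
next
  assume I: "ring_ideal I"
  interpret R: cring "ring_of_type_algebra :: 'a ring" by (rule cring_from_type_algebra)
  show "ideal I (ring_of_type_algebra :: 'a ring)"
  proof (rule idealI[OF R.ring_axioms])
    show "subgroup I (add_monoid (ring_of_type_algebra :: 'a ring))"
    proof (rule R.add.subgroupI)
      show "\<ominus>\<^bsub>ring_of_type_algebra\<^esub> a \<in> I" if "a \<in> I" for a
      proof -
        have "\<ominus>\<^bsub>ring_of_type_algebra\<^esub> a = - a"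
          by (rule R.minus_equality) (auto simp: ring_of_type_algebra_def)
        with mult_module.subspace_neg[OF I that] show ?thesis by simp
      qed
    qed (use I in \<open>auto simp: mult_module.subspace_def ring_of_type_algebra_def\<close>)
    show "x \<otimes>\<^bsub>ring_of_type_algebra\<^esub> a \<in> I" "a \<otimes>\<^bsub>ring_of_type_algebra\<^esub> x \<in> I" if "a \<in> I" for a x
      using mult_module.subspace_scale[OF I that, of x]
      by (simp_all add: ring_of_type_algebra_def mult.commute)
  qed
qed

lemma ring_ideal_Idl: "ring_ideal (Idl\<^bsub>ring_of_type_algebra\<^esub> (S :: 'a::comm_ring_1 set))"
proof -
  interpret R: cring "ring_of_type_algebra :: 'a ring" by (rule cring_from_type_algebra)
  show ?thesis
    using R.genideal_ideal[of S]
    by (simp add: ideal_ring_of_type_algebra_iff) (simp add: ring_of_type_algebra_def)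
qed

lemma subset_Idl: "S \<subseteq> Idl\<^bsub>ring_of_type_algebra\<^esub> (S :: 'a::comm_ring_1 set)"
proof -
  interpret R: cring "ring_of_type_algebra :: 'a ring" by (rule cring_from_type_algebra)
  show ?thesis by (rule R.genideal_self) (simp add: ring_of_type_algebra_def)
qed

lemma Idl_minimal:
  "ring_ideal I \<Longrightarrow> S \<subseteq> I \<Longrightarrow> Idl\<^bsub>ring_of_type_algebra\<^esub> (S :: 'a::comm_ring_1 set) \<subseteq> I"
  by (rule ring.genideal_minimal[OF ring_from_type_algebra])
     (simp_all add: ideal_ring_of_type_algebra_iff)

lemma Idl_subset_iff:
  "ring_ideal I \<Longrightarrow> Idl\<^bsub>ring_of_type_algebra\<^esub> (S :: 'a::comm_ring_1 set) \<subseteq> I \<longleftrightarrow> S \<subseteq> I"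
  using Idl_minimal subset_Idl by blast

text \<open>Ring homomorphisms between type-class rings. All coefficient maps, shifts, embeddings and
  evaluations below are of this kind, so that identities between them need checking on generators
  only.\<close>
definition ring_map :: "('a::comm_ring_1 \<Rightarrow> 'b::comm_ring_1) \<Rightarrow> bool" where
  "ring_map f \<longleftrightarrow> f 1 = 1 \<and> (\<forall>a b. f (a + b) = f a + f b) \<and> (\<forall>a b. f (a * b) = f a * f b)"

lemma ring_mapI:
  "f 1 = 1 \<Longrightarrow> (\<And>a b. f (a + b) = f a + f b) \<Longrightarrow> (\<And>a b. f (a * b) = f a * f b) \<Longrightarrow> ring_map f"
  by (simp add: ring_map_def)

lemma
  assumes "ring_map f"
  shows ring_map_one: "f 1 = 1"
    and ring_map_add: "f (a + b) = f a + f b"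
    and ring_map_mult: "f (a * b) = f a * f b"
  using assms by (auto simp: ring_map_def)

lemma ring_map_zero: "ring_map f \<Longrightarrow> f 0 = 0"
  using ring_map_add[of f 0 0] by simp

lemma ring_map_uminus: "ring_map f \<Longrightarrow> f (- a) = - f a"
  using ring_map_add[of f a "- a"] by (simp add: ring_map_zero minus_unique)

lemma ring_map_diff: "ring_map f \<Longrightarrow> f (a - b) = f a - f b"
  using ring_map_add[of f a "- b"] by (simp add: ring_map_uminus)

lemma ring_map_sum: "ring_map f \<Longrightarrow> f (sum g A) = (\<Sum>x\<in>A. f (g x))"
  by (induction A rule: infinite_finite_induct) (auto simp: ring_map_zero ring_map_add)

lemma ring_map_prod: "ring_map f \<Longrightarrow> f (prod g A) = (\<Prod>x\<in>A. f (g x))"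
  by (induction A rule: infinite_finite_induct) (auto simp: ring_map_one ring_map_mult)

lemma ring_map_id: "ring_map (\<lambda>x. x)"
  by (simp add: ring_map_def)

lemma ring_map_comp: "ring_map f \<Longrightarrow> ring_map g \<Longrightarrow> ring_map (\<lambda>x. f (g x))"
  by (simp add: ring_map_def)

lemma ring_map_funpow: "ring_map f \<Longrightarrow> ring_map ((f :: 'a::comm_ring_1 \<Rightarrow> 'a) ^^ n)"
  by (induction n) (auto simp: ring_map_def)

lemma ring_map_inv: "ring_map f \<Longrightarrow> bij f \<Longrightarrow> ring_map (inv_into UNIV f)"
proof (rule ring_mapI)
  assume f: "ring_map f" and b: "bij f"
  note surj = surj_f_inv_f[OF bij_is_surj[OF b]]
  note inj = inv_f_f[OF bij_is_inj[OF b]]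
  show "inv_into UNIV f 1 = 1" using inj[of 1] f by (simp add: ring_map_one)
  show "inv_into UNIV f (x + y) = inv_into UNIV f x + inv_into UNIV f y" for x y
    using inj[of "inv_into UNIV f x + inv_into UNIV f y"] f by (simp add: ring_map_add surj)
  show "inv_into UNIV f (x * y) = inv_into UNIV f x * inv_into UNIV f y" for x y
    using inj[of "inv_into UNIV f x * inv_into UNIV f y"] f by (simp add: ring_map_mult surj)
qed

lemma ring_map_int_funpow: "ring_map f \<Longrightarrow> bij f \<Longrightarrow> ring_map (int_funpow f j)"
  by (auto simp: int_funpow_def ring_map_funpow ring_map_inv)

lemma ring_map_iff_ring_hom:
  "ring_map f \<longleftrightarrow> f \<in> ring_hom ring_of_type_algebra ring_of_type_algebra"
  by (auto simp: ring_map_def ring_hom_def ring_of_type_algebra_def)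

lemma ring_ideal_vimage: "ring_map f \<Longrightarrow> ring_ideal I \<Longrightarrow> ring_ideal {x. f x \<in> I}"
  by (auto simp: mult_module.subspace_def ring_map_zero ring_map_add ring_map_mult)

section \<open>The universal property of polynomial rings\<close>

abbreviation pconst :: "'k::comm_ring_1 \<Rightarrow> ('v \<Rightarrow>\<^sub>0 nat) \<Rightarrow>\<^sub>0 'k" where
  "pconst c \<equiv> Poly_Mapping.single 0 c"

abbreviation pvar :: "'v \<Rightarrow> ('v \<Rightarrow>\<^sub>0 nat) \<Rightarrow>\<^sub>0 'k::comm_ring_1" where
  "pvar v \<equiv> Poly_Mapping.single (Poly_Mapping.single v (Suc 0)) 1"

lemma poly_mapping_eq_sum_single:
  "p = (\<Sum>m\<in>Poly_Mapping.keys p. Poly_Mapping.single m (Poly_Mapping.lookup p m))"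
proof (rule poly_mapping_eqI)
  fix k
  have "Poly_Mapping.lookup (\<Sum>m\<in>Poly_Mapping.keys p. Poly_Mapping.single m (Poly_Mapping.lookup p m)) k
      = (\<Sum>m\<in>Poly_Mapping.keys p. if m = k then Poly_Mapping.lookup p m else 0)"
    by (simp add: lookup_sum lookup_single when_def)
  also have "\<dots> = Poly_Mapping.lookup p k"
    by (simp add: in_keys_iff)
  finally show "Poly_Mapping.lookup p k =
    Poly_Mapping.lookup (\<Sum>m\<in>Poly_Mapping.keys p. Poly_Mapping.single m (Poly_Mapping.lookup p m)) k"
    by simp
qed

lemma prod_single:
  "finite A \<Longrightarrow>
   (\<Prod>x\<in>A. Poly_Mapping.single (f x) 1) = Poly_Mapping.single (sum f A) (1 :: 'k::comm_ring_1)"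
  by (induction A rule: finite_induct) (auto simp: mult_single)

lemma pvar_power: "pvar v ^ k = Poly_Mapping.single (Poly_Mapping.single v k) (1 :: 'k::comm_ring_1)"
  by (induction k) (auto simp: mult_single single_add[symmetric])

lemma monomial_eq:
  "Poly_Mapping.single m (c :: 'k::comm_ring_1) =
     pconst c * (\<Prod>v\<in>Poly_Mapping.keys m. pvar v ^ Poly_Mapping.lookup m v)"
proof -
  have "(\<Prod>v\<in>Poly_Mapping.keys m. pvar v ^ Poly_Mapping.lookup m v) = Poly_Mapping.single m (1::'k)"
    unfolding pvar_power
    by (subst prod_single) (simp_all flip: poly_mapping_eq_sum_single)
  thus ?thesis by (simp add: mult_single)
qed

text \<open>Every monomial is a constant times a product of powers of variables, and every polynomial is a
  sum of monomials.\<close>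

lemma polynomial_induct [case_names const var add mult]:
  fixes p :: "('v \<Rightarrow>\<^sub>0 nat) \<Rightarrow>\<^sub>0 'k::comm_ring_1"
  assumes const: "\<And>c. P (pconst c)" and var: "\<And>v. P (pvar v)"
    and add: "\<And>p q. P p \<Longrightarrow> P q \<Longrightarrow> P (p + q)"
    and mult: "\<And>p q. P p \<Longrightarrow> P q \<Longrightarrow> P (p * q)"
  shows "P p"
proof -
  have 0: "P 0" and 1: "P 1" using const[of 0] const[of 1] by simp_all
  have pow: "P (pvar v ^ k)" for v and k :: nat
    by (induction k) (auto intro: 1 var mult)
  have "P (\<Prod>v\<in>A. pvar v ^ f v)" for A :: "'v set" and f :: "'v \<Rightarrow> nat"
    by (induction A rule: infinite_finite_induct) (auto intro: 1 pow mult)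
  hence mono: "P (Poly_Mapping.single m c)" for m c
    unfolding monomial_eq[of m c] by (intro mult const)
  have "P (\<Sum>m\<in>A. Poly_Mapping.single m (f m))" for A :: "('v \<Rightarrow>\<^sub>0 nat) set" and f
    by (induction A rule: infinite_finite_induct) (auto intro: 0 mono add)
  thus ?thesis by (subst poly_mapping_eq_sum_single)
qed

text \<open>The common form of substituting values (\<open>dsubst\<close>) and of renaming indeterminates
  (\<open>dpoly_map\<close>), which therefore share one proof of being homomorphisms.\<close>
definition poly_eval ::
    "('k::comm_ring_1 \<Rightarrow> 'r::comm_ring_1) \<Rightarrow> ('v \<Rightarrow> 'r) \<Rightarrow> (('v \<Rightarrow>\<^sub>0 nat) \<Rightarrow>\<^sub>0 'k) \<Rightarrow> 'r" where
  "poly_eval c \<alpha> p =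
     (\<Sum>m\<in>Poly_Mapping.keys p.
        c (Poly_Mapping.lookup p m) * (\<Prod>v\<in>Poly_Mapping.keys m. \<alpha> v ^ Poly_Mapping.lookup m v))"

lemma poly_eval_superset:
  assumes "ring_map c" "finite A" "Poly_Mapping.keys p \<subseteq> A"
  shows "poly_eval c \<alpha> p =
    (\<Sum>m\<in>A. c (Poly_Mapping.lookup p m) * (\<Prod>v\<in>Poly_Mapping.keys m. \<alpha> v ^ Poly_Mapping.lookup m v))"
  unfolding poly_eval_def
  by (rule sum.mono_neutral_left) (use assms in \<open>auto simp: in_keys_iff ring_map_zero\<close>)

lemma poly_eval_add:
  assumes "ring_map c"
  shows "poly_eval c \<alpha> (p + q) = poly_eval c \<alpha> p + poly_eval c \<alpha> q"
proof -
  let ?A = "Poly_Mapping.keys p \<union> Poly_Mapping.keys q"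
  have "poly_eval c \<alpha> r =
     (\<Sum>m\<in>?A. c (Poly_Mapping.lookup r m) * (\<Prod>v\<in>Poly_Mapping.keys m. \<alpha> v ^ Poly_Mapping.lookup m v))"
    if "Poly_Mapping.keys r \<subseteq> ?A" for r
    using assms that by (intro poly_eval_superset) auto
  from this[of p] this[of q] this[of "p + q"] show ?thesis
    using assms Poly_Mapping.keys_add[of p q]
    by (simp add: lookup_add ring_map_add distrib_right sum.distrib)
qed

lemma poly_eval_sum:
  assumes "ring_map c"
  shows "poly_eval c \<alpha> (\<Sum>x\<in>A. f x) = (\<Sum>x\<in>A. poly_eval c \<alpha> (f x))"
proof -
  have "poly_eval c \<alpha> 0 = 0" by (simp add: poly_eval_def)
  thus ?thesis
    by (induction A rule: infinite_finite_induct) (auto simp: poly_eval_add[OF assms])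
qed

lemma poly_eval_single:
  assumes "ring_map c"
  shows "poly_eval c \<alpha> (Poly_Mapping.single m a) =
    c a * (\<Prod>v\<in>Poly_Mapping.keys m. \<alpha> v ^ Poly_Mapping.lookup m v)"
  using assms by (simp add: poly_eval_def ring_map_zero)

lemma monomial_value_add:
  fixes \<alpha> :: "'v \<Rightarrow> 'r::comm_ring_1" and m m' :: "'v \<Rightarrow>\<^sub>0 nat"
  shows "(\<Prod>v\<in>Poly_Mapping.keys (m + m'). \<alpha> v ^ Poly_Mapping.lookup (m + m') v) =
    (\<Prod>v\<in>Poly_Mapping.keys m. \<alpha> v ^ Poly_Mapping.lookup m v) *
    (\<Prod>v\<in>Poly_Mapping.keys m'. \<alpha> v ^ Poly_Mapping.lookup m' v)"
proof -
  let ?A = "Poly_Mapping.keys m \<union> Poly_Mapping.keys m'"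
  have "(\<Prod>v\<in>Poly_Mapping.keys r. \<alpha> v ^ Poly_Mapping.lookup r v) = (\<Prod>v\<in>?A. \<alpha> v ^ Poly_Mapping.lookup r v)"
    if "Poly_Mapping.keys r \<subseteq> ?A" for r
    by (rule prod.mono_neutral_left) (use that in \<open>auto simp: in_keys_iff\<close>)
  from this[of m] this[of m'] this[of "m + m'"] show ?thesis
    using Poly_Mapping.keys_add[of m m']
    by (simp add: lookup_add power_add prod.distrib)
qed

text \<open>Products are expanded into double sums of monomials, on which multiplicativity is the addition
  law for exponents.\<close>
lemma ring_map_poly_eval:
  assumes "ring_map c"
  shows "ring_map (poly_eval c \<alpha>)"
proof (rule ring_mapI)
  have "poly_eval c \<alpha> (Poly_Mapping.single 0 1) = 1"
    by (subst poly_eval_single[OF assms]) (simp add: ring_map_one[OF assms])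
  thus "poly_eval c \<alpha> 1 = 1" by simp
  show "poly_eval c \<alpha> (p + q) = poly_eval c \<alpha> p + poly_eval c \<alpha> q" for p q
    by (rule poly_eval_add[OF assms])
  show "poly_eval c \<alpha> (p * q) = poly_eval c \<alpha> p * poly_eval c \<alpha> q" for p q
  proof -
    let ?s = "\<lambda>p m. Poly_Mapping.single m (Poly_Mapping.lookup p m)"
    have expand: "(\<Sum>m\<in>Poly_Mapping.keys r. poly_eval c \<alpha> (?s r m)) = poly_eval c \<alpha> r" for r
      unfolding poly_eval_sum[OF assms, symmetric] by (simp flip: poly_mapping_eq_sum_single)
    have "p * q = (\<Sum>m\<in>Poly_Mapping.keys p. \<Sum>m'\<in>Poly_Mapping.keys q. ?s p m * ?s q m')"
      by (subst poly_mapping_eq_sum_single[of p], subst poly_mapping_eq_sum_single[of q])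
         (simp add: sum_product)
    hence "poly_eval c \<alpha> (p * q) =
      (\<Sum>m\<in>Poly_Mapping.keys p. \<Sum>m'\<in>Poly_Mapping.keys q. poly_eval c \<alpha> (?s p m * ?s q m'))"
      by (simp add: poly_eval_sum[OF assms])
    also have "\<dots> = (\<Sum>m\<in>Poly_Mapping.keys p. \<Sum>m'\<in>Poly_Mapping.keys q.
                    poly_eval c \<alpha> (?s p m) * poly_eval c \<alpha> (?s q m'))"
      by (intro sum.cong refl)
         (simp add: mult_single poly_eval_single[OF assms] monomial_value_add ring_map_mult[OF assms])
    also have "\<dots> = poly_eval c \<alpha> p * poly_eval c \<alpha> q"
      by (simp only: sum_product[symmetric] expand)
    finally show ?thesis .
  qed
qed

lemma poly_eval_const: "ring_map c \<Longrightarrow> poly_eval c \<alpha> (pconst a) = c a"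
  by (simp add: poly_eval_single)

lemma poly_eval_var: "ring_map c \<Longrightarrow> poly_eval c \<alpha> (pvar v) = \<alpha> v"
  by (simp add: poly_eval_single ring_map_one)

lemma ring_map_eqI:
  fixes \<Phi> \<Psi> :: "(('v \<Rightarrow>\<^sub>0 nat) \<Rightarrow>\<^sub>0 'k::comm_ring_1) \<Rightarrow> 'r::comm_ring_1"
  assumes "ring_map \<Phi>" "ring_map \<Psi>"
    and "\<And>c. \<Phi> (pconst c) = \<Psi> (pconst c)" "\<And>v. \<Phi> (pvar v) = \<Psi> (pvar v)"
  shows "\<Phi> p = \<Psi> p"
  by (induction p rule: polynomial_induct)
     (simp_all only: assms(3,4) ring_map_add[OF assms(1)] ring_map_add[OF assms(2)]
       ring_map_mult[OF assms(1)] ring_map_mult[OF assms(2)])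

lemma poly_eval_unique:
  assumes "ring_map \<Phi>" "\<And>a. \<Phi> (pconst a) = c a" "\<And>v. \<Phi> (pvar v) = \<alpha> v" "ring_map c"
  shows "\<Phi> p = poly_eval c \<alpha> p"
proof (rule ring_map_eqI)
  show "ring_map (poly_eval c \<alpha>)" by (rule ring_map_poly_eval[OF assms(4)])
  show "\<Phi> (pconst a) = poly_eval c \<alpha> (pconst a)" for a
    unfolding poly_eval_const[OF assms(4)] by (rule assms)
  show "\<Phi> (pvar v) = poly_eval c \<alpha> (pvar v)" for v
    unfolding poly_eval_var[OF assms(4)] by (rule assms)
qed (rule assms)

lemma ring_map_pconst: "ring_map (pconst :: 'k::comm_ring_1 \<Rightarrow> _)"
  by (auto simp: ring_map_def single_add mult_single)

section \<open>Hilbert's Nullstellensatz in countably many variables\<close>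

text \<open>A countable set has only countably many finite subsets, each vector lies in the span of one of
  them, and such a span contains only finitely many members of an independent set.\<close>
lemma (in vector_space) countable_independent:
  assumes "countable B" "span B = UNIV" "independent S"
  shows "countable S"
proof -
  let ?T = "{T. finite T \<and> T \<subseteq> B}"
  have "S \<subseteq> (\<Union>T\<in>?T. S \<inter> span T)"
  proof
    fix x assume "x \<in> S"
    have "x \<in> span B" using assms(2) by simp
    then obtain T r where "finite T" "T \<subseteq> B" "x = (\<Sum>a\<in>T. r a *s a)"
      unfolding span_explicit by auto
    moreover from this have "x \<in> span T"
      by (auto intro: span_sum span_scale span_base)
    ultimately show "x \<in> (\<Union>T\<in>?T. S \<inter> span T)" using \<open>x \<in> S\<close> by blast
  qed
  moreover have "finite (S \<inter> span T)" if "T \<in> ?T" for T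
  proof -
    have "independent (S \<inter> span T)" using assms(3) by (rule independent_mono) auto
    with that show ?thesis using independent_span_bound[of T "S \<inter> span T"] by auto
  qed
  hence "countable (\<Union>T\<in>?T. S \<inter> span T)"
    using countable_Collect_finite_subset[OF assms(1)] by (intro countable_UN) (auto intro: countable_finite)
  ultimately show ?thesis by (rule countable_subset)
qed

lemma countable_finite_support:
  assumes "countable (UNIV :: 'v set)"
  shows "countable (UNIV :: ('v \<Rightarrow>\<^sub>0 nat) set)"
proof (rule countable_image_inj_on)
  let ?g = "\<lambda>m :: 'v \<Rightarrow>\<^sub>0 nat. (\<lambda>v. (v, Poly_Mapping.lookup m v)) ` Poly_Mapping.keys m"
  have "range ?g \<subseteq> {A. finite A \<and> A \<subseteq> UNIV \<times> UNIV}" by auto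
  moreover have "countable {A :: ('v \<times> nat) set. finite A \<and> A \<subseteq> UNIV \<times> UNIV}"
    using assms by (intro countable_Collect_finite_subset countable_SIGMA) auto
  ultimately show "countable (range ?g)" by (rule countable_subset)
  show "inj ?g"
  proof (rule injI)
    fix m m' assume eq: "?g m = ?g m'"
    show "m = m'"
    proof (rule poly_mapping_eqI)
      fix v
      have mem: "(v, k) \<in> ?g m \<longleftrightarrow> Poly_Mapping.lookup m v = k \<and> k \<noteq> 0" for m k
        by (auto simp: in_keys_iff)
      have "Poly_Mapping.lookup m v = k \<and> k \<noteq> 0 \<longleftrightarrow> Poly_Mapping.lookup m' v = k \<and> k \<noteq> 0" for k
        unfolding mem[symmetric] eq ..
      from this[of "Poly_Mapping.lookup m v"] this[of "Poly_Mapping.lookup m' v"]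
      show "Poly_Mapping.lookup m v = Poly_Mapping.lookup m' v" by auto
    qed
  qed
qed

text \<open>The monomials form a countable basis, so an uncountable family of distinct polynomials cannot be
  linearly independent.\<close>
lemma uncountable_family_dependent:
  fixes g :: "'k::field \<Rightarrow> ('v \<Rightarrow>\<^sub>0 nat) \<Rightarrow>\<^sub>0 'k"
  assumes "countable (UNIV :: 'v set)" "uncountable (UNIV :: 'k set)" "inj g"
  obtains S u c where "finite S" "(\<Sum>d\<in>S. pconst (u d) * g d) = 0" "c \<in> S" "u c \<noteq> 0"
proof -
  interpret vs: vector_space "\<lambda>c (p :: ('v \<Rightarrow>\<^sub>0 nat) \<Rightarrow>\<^sub>0 'k). pconst c * p"
    by standard (simp_all add: distrib_left distrib_right single_add mult_single flip: mult.assoc)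
  let ?B = "range (\<lambda>m. Poly_Mapping.single m (1::'k)) :: (('v \<Rightarrow>\<^sub>0 nat) \<Rightarrow>\<^sub>0 'k) set"
  have "p \<in> vs.span ?B" for p
  proof (subst poly_mapping_eq_sum_single, rule vs.span_sum)
    fix m
    have "pconst (Poly_Mapping.lookup p m) * Poly_Mapping.single m 1 \<in> vs.span ?B"
      by (intro vs.span_scale vs.span_base) auto
    thus "Poly_Mapping.single m (Poly_Mapping.lookup p m) \<in> vs.span ?B"
      by (simp add: mult_single)
  qed
  hence span: "vs.span ?B = UNIV" by auto
  have "countable ?B" using countable_finite_support[OF assms(1)] by (rule countable_image)
  from vs.countable_independent[OF this span]
  have "vs.dependent (range g)"
    using countable_image_inj_eq[OF assms(3)] assms(2) by blast
  then obtain T u w where T: "finite T" "T \<subseteq> range g"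
    "(\<Sum>v\<in>T. pconst (u v) * v) = 0" "w \<in> T" "u w \<noteq> 0"
    unfolding vs.dependent_explicit by blast
  from T(2) obtain S where S: "T = g ` S" by (auto simp: subset_image_iff)
  have inj: "inj_on g S" using assms(3) by (rule inj_on_subset) simp
  show thesis
    using T S sum.reindex[OF inj, of "\<lambda>v. pconst (u v) * v"] finite_image_iff[OF inj]
    by (intro that[of S "u \<circ> g" "inv_into S g w"]) (auto simp: inv_into_into f_inv_into_f inj)
qed

text \<open>Maximality enters only as invertibility modulo \<open>M\<close> of every element outside \<open>M\<close>, so this is the
  form in which it is recorded; the quotient field itself is never formed.\<close>
lemma maximal_ideal_exists:
  fixes I :: "'a::comm_ring_1 set"
  assumes "ring_ideal I" "1 \<notin> I"
  obtains M where "ring_ideal M" "I \<subseteq> M" "1 \<notin> M"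
    "\<And>a. a \<notin> M \<Longrightarrow> \<exists>g. g * a - 1 \<in> M"
proof -
  define \<A> where "\<A> = {J. ring_ideal J \<and> I \<subseteq> J \<and> 1 \<notin> J}"
  have "\<exists>M\<in>\<A>. \<forall>P\<in>\<A>. M \<subseteq> P \<longrightarrow> P = M"
  proof (rule subset_Zorn_nonempty)
    show "\<A> \<noteq> {}" using assms by (auto simp: \<A>_def)
    fix C assume C: "C \<noteq> {}" "subset.chain \<A> C"
    from C(2) have sub: "\<And>P. P \<in> C \<Longrightarrow> ring_ideal P \<and> I \<subseteq> P \<and> 1 \<notin> P"
      and total: "\<And>P Q. P \<in> C \<Longrightarrow> Q \<in> C \<Longrightarrow> P \<subseteq> Q \<or> Q \<subseteq> P"
      unfolding \<A>_def subset_chain_def by blast+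
    have "ring_ideal (\<Union>C)"
    proof (rule mult_module.subspaceI)
      from C(1) obtain P where P: "P \<in> C" by blast
      with sub have "0 \<in> P" by (intro mult_module.subspace_0) simp
      with P show "0 \<in> \<Union>C" by blast
      show "x + y \<in> \<Union>C" if xy: "x \<in> \<Union>C" "y \<in> \<Union>C" for x y
      proof -
        from xy obtain P Q where "P \<in> C" "Q \<in> C" "x \<in> P" "y \<in> Q" by blast
        with total[of P Q] obtain U where U: "U \<in> C" "x \<in> U" "y \<in> U" by blast
        with sub have "x + y \<in> U" by (intro mult_module.subspace_add) simp_all
        with U show ?thesis by blast
      qed
      show "c * x \<in> \<Union>C" if x: "x \<in> \<Union>C" for c x
      proof -
        from x obtain U where U: "U \<in> C" "x \<in> U" by blast
        with sub have "c * x \<in> U" by (intro mult_module.subspace_scale) simp_all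
        with U show ?thesis by blast
      qed
    qed
    moreover have "I \<subseteq> \<Union>C"
    proof -
      from C(1) obtain P where "P \<in> C" by blast
      with sub show ?thesis by blast
    qed
    moreover have "1 \<notin> \<Union>C" using sub by blast
    ultimately show "\<Union>C \<in> \<A>" by (simp add: \<A>_def)
  qed
  then obtain M where "M \<in> \<A>" and max: "\<And>P. P \<in> \<A> \<Longrightarrow> M \<subseteq> P \<Longrightarrow> P = M" by blast
  hence M: "ring_ideal M" "I \<subseteq> M" "1 \<notin> M" by (simp_all add: \<A>_def)
  have "\<exists>g. g * a - 1 \<in> M" if "a \<notin> M" for a
  proof -
    (* P is the ideal generated by M and a. *)
    define P where "P = {x. \<exists>r. x - r * a \<in> M}"
    have P: "x \<in> P" if "x - r * a \<in> M" for x r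
      using that by (auto simp: P_def)
    have "ring_ideal P"
    proof (rule mult_module.subspaceI)
      show "0 \<in> P" using mult_module.subspace_0[OF M(1)] by (intro P[of _ 0]) simp
      show "x + y \<in> P" if xy: "x \<in> P" "y \<in> P" for x y
      proof -
        from xy obtain r s where "x - r * a \<in> M" "y - s * a \<in> M" by (auto simp: P_def)
        from mult_module.subspace_add[OF M(1) this] have "x + y - (r + s) * a \<in> M"
          by (simp add: distrib_right add_diff_add)
        thus ?thesis by (rule P)
      qed
      show "c * x \<in> P" if x: "x \<in> P" for c x
      proof -
        from x obtain r where "x - r * a \<in> M" by (auto simp: P_def)
        from mult_module.subspace_scale[OF M(1) this, of c] have "c * x - c * r * a \<in> M"
          by (simp add: right_diff_distrib mult.assoc)
        thus ?thesis by (rule P)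
      qed
    qed
    moreover have MP: "M \<subseteq> P" by (intro subsetI P[of _ 0]) simp
    moreover have "a \<in> P" using mult_module.subspace_0[OF M(1)] by (intro P[of _ 1]) simp
    ultimately have "P \<notin> \<A>" using max[OF _ MP] that by auto
    with \<open>ring_ideal P\<close> MP M(2) have "1 \<in> P" by (auto simp: \<A>_def)
    then obtain r where "1 - r * a \<in> M" by (auto simp: P_def)
    from mult_module.subspace_neg[OF M(1) this] have "r * a - 1 \<in> M" by simp
    thus ?thesis by blast
  qed
  thus thesis by (rule that[OF M])
qed

definition univ_eval :: "(('v \<Rightarrow>\<^sub>0 nat) \<Rightarrow>\<^sub>0 'k) \<Rightarrow> 'k::comm_ring_1 poly \<Rightarrow> (('v \<Rightarrow>\<^sub>0 nat) \<Rightarrow>\<^sub>0 'k)" where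
  "univ_eval x q = poly (map_poly pconst q) x"

lemma univ_eval_pCons: "univ_eval x (pCons a q) = pconst a + x * univ_eval x q"
  by (simp add: univ_eval_def map_poly_pCons)

lemma univ_eval_smult: "univ_eval x (smult a q) = pconst a * univ_eval x q"
  by (simp add: univ_eval_def map_poly_smult mult_single)

lemma ring_map_univ_eval:
  fixes x :: "('v \<Rightarrow>\<^sub>0 nat) \<Rightarrow>\<^sub>0 'k::comm_ring_1"
  shows "ring_map (univ_eval x)"
proof (rule ring_mapI)
  show "univ_eval x 1 = 1" by (simp add: univ_eval_def)
  have map_add: "map_poly pconst (p + q) = map_poly pconst p + map_poly pconst q" for p q :: "'k poly"
    by (rule poly_eqI) (simp add: coeff_map_poly single_add)
  show add: "univ_eval x (p + q) = univ_eval x p + univ_eval x q" for p q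
    unfolding univ_eval_def map_add by simp
  show "univ_eval x (p * q) = univ_eval x p * univ_eval x q" for p q
  proof (induction p)
    case 0 show ?case by (simp add: univ_eval_def)
  next
    case (pCons a p)
    have "univ_eval x (pCons a p * q) = pconst a * univ_eval x q + x * univ_eval x (p * q)"
      by (simp add: add univ_eval_smult univ_eval_pCons)
    also have "\<dots> = univ_eval x (pCons a p) * univ_eval x q"
      unfolding pCons.IH univ_eval_pCons by (simp only: distrib_right mult.assoc)
    finally show ?case .
  qed
qed

text \<open>If every \<open>x - c\<close> is invertible modulo \<open>M\<close>, then \<open>x\<close> is transcendental over the algebraically closed
  ground field modulo \<open>M\<close>: the linear factors of \<open>q\<close> can be cancelled one after the other.\<close>
lemma univ_eval_in_maximal_ideal:
  fixes q :: "'k::alg_closed_field poly" and x :: "('v \<Rightarrow>\<^sub>0 nat) \<Rightarrow>\<^sub>0 'k"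
  assumes M: "ring_ideal M" "1 \<notin> M" "\<And>c. \<exists>g. g * (x - pconst c) - 1 \<in> M"
    and q: "q \<noteq> 0" "univ_eval x q \<in> M"
  shows False
  using q
proof (induction "degree q" arbitrary: q)
  case 0
  then obtain a where a: "q = [:a:]" "a \<noteq> 0" by (metis degree_eq_zeroE pCons_0_0)
  hence "univ_eval x q = pconst a" by (simp add: univ_eval_def map_poly_pCons)
  with mult_module.subspace_scale[OF M(1) 0(3), of "pconst (inverse a)"] a M(2)
  show False by (simp add: mult_single)
next
  case (Suc n)
  then obtain c where "poly q c = 0" using alg_closed_imp_poly_has_root[of q] by auto
  then obtain r where r: "q = [:- c, 1:] * r" by (metis dvdE poly_eq_0_iff_dvd)
  with Suc have r0: "r \<noteq> 0" by auto
  have "degree q = 1 + degree r" unfolding r using r0 by (subst degree_mult_eq) auto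
  with Suc(2) have deg: "n = degree r" by simp
  obtain g where g: "g * (x - pconst c) - 1 \<in> M" using M(3) by blast
  have "univ_eval x [:- c, 1:] = x - pconst c"
    by (simp add: univ_eval_def map_poly_pCons single_uminus)
  hence qr: "univ_eval x q = (x - pconst c) * univ_eval x r"
    unfolding r ring_map_mult[OF ring_map_univ_eval] by (rule arg_cong)
  have "univ_eval x r = g * univ_eval x q - univ_eval x r * (g * (x - pconst c) - 1)"
    unfolding qr by (simp add: algebra_simps)
  also have "\<dots> \<in> M"
    by (intro mult_module.subspace_diff[OF M(1)] mult_module.subspace_scale[OF M(1) Suc(4)]
        mult_module.subspace_scale[OF M(1) g])
  finally show False using Suc(1)[OF deg r0] by blast
qed

text \<open>If no constant \<open>c\<close> had \<open>x - c\<close> in \<open>M\<close>, each \<open>x - c\<close> would have an inverse \<open>g c\<close> modulo \<open>M\<close>. These would be uncountably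
  many distinct polynomials, so some finite combination \<open>\<Sum> u d * g d\<close> vanishes. Clearing denominators, that is,
  multiplying by \<open>\<Prod> (x - d)\<close>, turns it into an algebraic relation for \<open>x\<close> modulo \<open>M\<close>; it is nontrivial
  because partial fractions with distinct poles are independent.\<close>
lemma variable_has_value_mod_maximal_ideal:
  fixes M :: "(('v \<Rightarrow>\<^sub>0 nat) \<Rightarrow>\<^sub>0 'k::alg_closed_field) set"
  assumes "countable (UNIV :: 'v set)" "uncountable (UNIV :: 'k set)"
    and M: "ring_ideal M" "1 \<notin> M" "\<And>a. a \<notin> M \<Longrightarrow> \<exists>g. g * a - 1 \<in> M"
  shows "\<exists>c. x - pconst c \<in> M"
proof (rule ccontr)
  assume "\<not> ?thesis"
  with M(3) have "\<exists>g. g * (x - pconst c) - 1 \<in> M" for c by blast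
  then obtain g where g: "\<And>c. g c * (x - pconst c) - 1 \<in> M" by metis
  have "inj g"
  proof (rule injI, rule ccontr)
    fix c d assume eq: "g c = g d" and ne: "c \<noteq> d"
    have "(g d * (x - pconst d) - 1) - (g c * (x - pconst c) - 1) = g c * pconst (c - d)"
      by (simp add: eq single_diff algebra_simps)
    with mult_module.subspace_diff[OF M(1) g[of d] g[of c]]
    have *: "g c * pconst (c - d) \<in> M" by simp
    have "g c = pconst (inverse (c - d)) * (g c * pconst (c - d))"
      using ne by (simp add: mult.left_commute mult_single)
    also have "\<dots> \<in> M" using mult_module.subspace_scale[OF M(1) *] .
    finally have "(x - pconst c) * g c \<in> M" by (rule mult_module.subspace_scale[OF M(1)])
    from mult_module.subspace_diff[OF M(1) this g[of c]] M(2) show False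
      by (simp add: algebra_simps)
  qed
  from uncountable_family_dependent[OF assms(1,2) this]
  obtain S u c where S: "finite S" "(\<Sum>d\<in>S. pconst (u d) * g d) = 0" "c \<in> S" "u c \<noteq> 0" .
  define q where "q = (\<Sum>d\<in>S. smult (u d) (\<Prod>e\<in>S - {d}. [:- e, 1:]))"
  have lin: "univ_eval x [:- e, 1:] = x - pconst e" for e
    by (simp add: univ_eval_def map_poly_pCons single_uminus)
  note hom = ring_map_univ_eval[of x]
  let ?P = "\<lambda>A. \<Prod>e\<in>A. x - pconst e"
  have "univ_eval x q = (\<Sum>d\<in>S. pconst (u d) * ?P (S - {d}))"
    by (simp add: q_def ring_map_sum[OF hom] univ_eval_smult ring_map_prod[OF hom] lin)
  also have "\<dots> = (\<Sum>d\<in>S. pconst (u d) * g d) * ?P S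
      - (\<Sum>d\<in>S. (pconst (u d) * ?P (S - {d})) * (g d * (x - pconst d) - 1))"
    unfolding sum_distrib_right sum_subtractf[symmetric]
    by (rule sum.cong[OF refl], subst prod.remove[OF S(1)]) (auto simp: algebra_simps)
  also have "\<dots> \<in> M"
    unfolding S(2) mult_zero_left
    by (rule mult_module.subspace_diff[OF M(1) mult_module.subspace_0[OF M(1)]],
        rule mult_module.subspace_sum[OF M(1)], rule mult_module.subspace_scale[OF M(1) g])
  finally have "univ_eval x q \<in> M" .
  (* At the pole c with u c \<noteq> 0 only the summand for c survives. *)
  moreover have "q \<noteq> 0"
  proof -
    have "poly q c = (\<Sum>d\<in>S. u d * (\<Prod>e\<in>S - {d}. c - e))"
      by (simp add: q_def poly_sum poly_prod)
    also have "\<dots> = (\<Sum>d\<in>{c}. u d * (\<Prod>e\<in>S - {d}. c - e))"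
      by (rule sum.mono_neutral_right) (use S in auto)
    also have "\<dots> \<noteq> 0" using S by auto
    finally show ?thesis by auto
  qed
  ultimately show False
    using univ_eval_in_maximal_ideal[OF M(1,2)] g by blast
qed

text \<open>A zero is found by sending each variable to the constant to which it is congruent modulo a
  maximal ideal \<open>M\<close> above \<open>I\<close>. Every polynomial is then congruent to its value, and a member of \<open>M\<close>
  with nonzero value would make \<open>M\<close> contain a unit.\<close>
lemma countable_nullstellensatz:
  fixes I :: "(('v \<Rightarrow>\<^sub>0 nat) \<Rightarrow>\<^sub>0 'k::alg_closed_field) set"
  assumes "countable (UNIV :: 'v set)" "uncountable (UNIV :: 'k set)"
    and "ring_ideal I" "1 \<notin> I"
  obtains \<alpha> where "\<And>p. p \<in> I \<Longrightarrow> poly_eval (\<lambda>c. c) \<alpha> p = 0"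
proof -
  obtain M where M: "ring_ideal M" "I \<subseteq> M" "1 \<notin> M"
    and max: "\<And>a. a \<notin> M \<Longrightarrow> \<exists>g. g * a - 1 \<in> M"
    using maximal_ideal_exists[OF assms(3,4)] by blast
  have "\<exists>c. pvar v - pconst c \<in> M" for v
    by (rule variable_has_value_mod_maximal_ideal[OF assms(1,2) M(1,3) max])
  then obtain \<alpha> where \<alpha>: "\<And>v. pvar v - pconst (\<alpha> v) \<in> M" by metis
  let ?E = "poly_eval (\<lambda>c. c) \<alpha>"
  note E = ring_map_poly_eval[OF ring_map_id, of \<alpha>]
  have congr: "p - pconst (?E p) \<in> M" for p
  proof (induction p rule: polynomial_induct)
    case (const c)
    show ?case using mult_module.subspace_0[OF M(1)] by (simp add: poly_eval_const[OF ring_map_id])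
  next
    case (var v)
    show ?case using \<alpha>[of v] unfolding poly_eval_var[OF ring_map_id] .
  next
    case (add p q)
    from mult_module.subspace_add[OF M(1) this] show ?case
      by (simp add: ring_map_add[OF E] single_add algebra_simps)
  next
    case (mult p q)
    have "p * q - pconst (?E (p * q)) =
        q * (p - pconst (?E p)) + pconst (?E p) * (q - pconst (?E q))"
      by (simp add: ring_map_mult[OF E] ring_map_mult[OF ring_map_pconst] algebra_simps)
    with mult show ?case
      by (simp add: mult_module.subspace_add[OF M(1)] mult_module.subspace_scale[OF M(1)])
  qed
  show thesis
  proof (rule that[of \<alpha>], rule ccontr)
    fix p assume p: "p \<in> I" and ne: "?E p \<noteq> 0"
    have "pconst (?E p) \<in> M"
      using mult_module.subspace_diff[OF M(1) _ congr[of p], of p] p M(2) by auto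
    from mult_module.subspace_scale[OF M(1) this, of "pconst (inverse (?E p))"] ne M(3)
    show False by (simp add: mult_single)
  qed
qed

section \<open>Shifts of difference polynomials\<close>

lemma dconst_eq: "dconst c = pconst c"
  by (simp add: dconst_def)

lemma dvar_eq: "dvar i j = pvar (i, j)"
  by (simp add: dvar_def)

lemma dsubst_eq_poly_eval: "dsubst \<alpha> = poly_eval (\<lambda>c. c) \<alpha>"
  by (rule ext) (simp add: dsubst_def poly_eval_def)

lemma ring_map_dsubst: "ring_map (dsubst \<alpha>)"
  unfolding dsubst_eq_poly_eval by (intro ring_map_poly_eval ring_map_id)

lemma dsubst_const [simp]: "dsubst \<alpha> (pconst c) = c"
  unfolding dsubst_eq_poly_eval by (rule poly_eval_const[OF ring_map_id])

lemma dsubst_var [simp]: "dsubst \<alpha> (pvar v) = \<alpha> v"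
  unfolding dsubst_eq_poly_eval by (rule poly_eval_var[OF ring_map_id])

lemma dpoly_map_eq_poly_eval: "dpoly_map g s = poly_eval (\<lambda>c. pconst (s c)) (\<lambda>v. pvar (g v))"
proof
  fix p
  show "dpoly_map g s p = poly_eval (\<lambda>c. pconst (s c)) (\<lambda>v. pvar (g v)) p"
    unfolding dpoly_map_def poly_eval_def pvar_power
    by (rule sum.cong) (simp_all add: prod_single mult_single)
qed

lemma
  assumes "ring_map s"
  shows ring_map_dpoly_map: "ring_map (dpoly_map g s)"
    and dpoly_map_const: "dpoly_map g s (pconst c) = pconst (s c)"
    and dpoly_map_var: "dpoly_map g s (pvar v) = pvar (g v)"
proof -
  have s: "ring_map (\<lambda>c. pconst (s c))" by (rule ring_map_comp[OF ring_map_pconst assms])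
  show "ring_map (dpoly_map g s)" "dpoly_map g s (pconst c) = pconst (s c)"
    "dpoly_map g s (pvar v) = pvar (g v)"
    unfolding dpoly_map_eq_poly_eval
    by (rule ring_map_poly_eval[OF s] poly_eval_const[OF s] poly_eval_var[OF s])+
qed

lemma
  assumes "ring_map \<sigma>"
  shows ring_map_dshift: "ring_map (dshift \<sigma>)"
    and dshift_const: "dshift \<sigma> (pconst c) = pconst (\<sigma> c)"
    and dshift_var: "dshift \<sigma> (pvar (i, j)) = pvar (i, j + 1)"
  unfolding dshift_def
  by (simp_all add: ring_map_dpoly_map[OF assms] dpoly_map_const[OF assms] dpoly_map_var[OF assms, simplified])

lemma
  shows ring_map_dembed: "ring_map dembed"
    and dembed_const: "dembed (pconst c) = pconst c"
    and dembed_var: "dembed (pvar (i, j)) = pvar (i, int j)"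
  unfolding dembed_def
  by (simp_all add: ring_map_dpoly_map[OF ring_map_id] dpoly_map_const[OF ring_map_id]
      dpoly_map_var[OF ring_map_id, simplified])

lemma dshift_funpow_const:
  "ring_map \<sigma> \<Longrightarrow> (dshift \<sigma> ^^ s) (pconst c) = pconst ((\<sigma> ^^ s) c)"
  by (induction s) (simp_all add: dshift_const)

lemma dshift_funpow_var:
  fixes j :: "'j::semiring_1"
  assumes "ring_map \<sigma>"
  shows "(dshift \<sigma> ^^ s) (pvar (i, j)) = pvar (i, j + of_nat s)"
  by (induction s) (simp_all add: dshift_var[OF assms, simplified] add_ac)

text \<open>Evaluating a shifted polynomial amounts to evaluating the original one with shifted coefficients
  and shifted arguments. The right-hand side exhibits which arguments matter, namely those at
  indices of \<open>p\<close> raised by \<open>s\<close>.\<close>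
lemma dsubst_dshift_funpow:
  assumes "ring_map \<sigma>"
  shows "dsubst \<alpha> ((dshift \<sigma> ^^ s) p) = poly_eval (\<sigma> ^^ s) (\<lambda>(i, j). \<alpha> (i, j + s)) p"
proof (rule poly_eval_unique[of "\<lambda>p. dsubst \<alpha> ((dshift \<sigma> ^^ s) p)"])
  show "ring_map (\<lambda>p. dsubst \<alpha> ((dshift \<sigma> ^^ s) p))"
    by (intro ring_map_comp[OF ring_map_dsubst] ring_map_funpow ring_map_dshift assms)
  show "dsubst \<alpha> ((dshift \<sigma> ^^ s) (pconst a)) = (\<sigma> ^^ s) a" for a
    by (simp add: dshift_funpow_const assms)
  show "dsubst \<alpha> ((dshift \<sigma> ^^ s) (pvar v)) = (case v of (i, j) \<Rightarrow> \<alpha> (i, j + s))" for v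
    by (cases v) (simp only: dshift_funpow_var[OF assms] dsubst_var prod.case of_nat_id)
  show "ring_map (\<sigma> ^^ s)" by (rule ring_map_funpow[OF assms])
qed

lemma dembed_dshift:
  assumes "ring_map \<sigma>"
  shows "dembed (dshift \<sigma> p) = dshift \<sigma> (dembed p)"
proof (rule ring_map_eqI[of "\<lambda>p. dembed (dshift \<sigma> p)" "\<lambda>p. dshift \<sigma> (dembed p)"])
  show "dembed (dshift \<sigma> (pvar v)) = dshift \<sigma> (dembed (pvar v))" for v
    by (cases v) (simp only: dembed_var dshift_var[OF assms], simp add: add.commute)
qed (simp_all add: assms ring_map_comp[OF ring_map_dembed ring_map_dshift]
      ring_map_comp[OF ring_map_dshift ring_map_dembed] dembed_const dshift_const)

lemma dembed_dshift_funpow: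
  "ring_map \<sigma> \<Longrightarrow> dembed ((dshift \<sigma> ^^ s) p) = (dshift \<sigma> ^^ s) (dembed p)"
  by (induction s) (simp_all add: dembed_dshift)

lemma inj_dembed: "inj (dembed :: ('n, nat, 'k::comm_ring_1) dpoly \<Rightarrow> _)"
proof (rule inj_on_inverseI)
  let ?r = "dpoly_map (\<lambda>(i, j). (i, nat j)) (\<lambda>c. c) :: ('n, int, 'k) dpoly \<Rightarrow> ('n, nat, 'k) dpoly"
  show "?r (dembed p) = p" for p
  proof (rule ring_map_eqI[of "\<lambda>p. ?r (dembed p)" "\<lambda>p. p"])
    show "?r (dembed (pvar v)) = pvar v" for v
      by (cases v) (simp only: dembed_var dpoly_map_var[OF ring_map_id] prod.case nat_int)
  qed (simp_all add: ring_map_comp[OF ring_map_dpoly_map ring_map_dembed] ring_map_id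
        dembed_const dpoly_map_const)
qed

lemma bij_dshift:
  assumes "ring_map \<sigma>" "bij \<sigma>"
  shows "bij (dshift \<sigma> :: ('n, int, 'k::comm_ring_1) dpoly \<Rightarrow> _)"
proof (rule o_bij)
  let ?s = "dshift \<sigma> :: ('n, int, 'k) dpoly \<Rightarrow> ('n, int, 'k) dpoly"
  let ?r = "dpoly_map (\<lambda>(i, j). (i, j - 1)) (inv_into UNIV \<sigma>) :: ('n, int, 'k) dpoly \<Rightarrow> ('n, int, 'k) dpoly"
  note inv = ring_map_inv[OF assms]
  have "?r (?s p) = p" for p
  proof (rule ring_map_eqI[of "\<lambda>p. ?r (?s p)" "\<lambda>p. p"])
    show "?r (?s (pvar v)) = pvar v" for v
      by (cases v) (simp only: dshift_var[OF assms(1)] dpoly_map_var[OF inv] prod.case, simp)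
  qed (simp_all add: ring_map_comp[OF ring_map_dpoly_map ring_map_dshift] ring_map_id assms inv
        dshift_const dpoly_map_const bij_is_inj)
  thus "?r \<circ> ?s = id" by auto
  have "?s (?r p) = p" for p
  proof (rule ring_map_eqI[of "\<lambda>p. ?s (?r p)" "\<lambda>p. p"])
    show "?s (?r (pvar v)) = pvar v" for v
      by (cases v) (simp only: dshift_var[OF assms(1)] dpoly_map_var[OF inv] prod.case, simp)
  qed (simp_all add: ring_map_comp[OF ring_map_dshift ring_map_dpoly_map] ring_map_id assms inv
        dshift_const dpoly_map_const surj_f_inv_f bij_is_surj)
  thus "?s \<circ> ?r = id" by auto
qed

lemma int_funpow_of_nat [simp]: "int_funpow f (int n) = f ^^ n"
  by (simp add: int_funpow_def)

lemma int_funpow_Suc: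
  assumes "bij f"
  shows "int_funpow f (k + 1) x = f (int_funpow f k x)"
proof (cases "0 \<le> k")
  case True
  hence "nat (k + 1) = Suc (nat k)" by simp
  with True show ?thesis by (simp add: int_funpow_def)
next
  case False
  define m where "m = nat (- k - 1)"
  from False have "k = - int (Suc m)" by (simp add: m_def)
  moreover have "f (inv_into UNIV f y) = y" for y
    by (rule surj_f_inv_f) (rule bij_is_surj[OF assms])
  ultimately show ?thesis by (cases m) (simp_all add: int_funpow_def nat_add_distrib)
qed

lemma int_funpow_Suc':
  assumes "bij f"
  shows "int_funpow f (k + 1) x = int_funpow f k (f x)"
proof (cases "0 \<le> k")
  case True
  hence "nat (k + 1) = Suc (nat k)" by simp
  with True show ?thesis by (simp add: int_funpow_def funpow_swap1)
next
  case False
  define m where "m = nat (- k - 1)"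
  from False have "k = - int (Suc m)" by (simp add: m_def)
  moreover have "inv_into UNIV f (f y) = y" for y
    by (rule inv_f_f) (rule bij_is_inj[OF assms])
  ultimately show ?thesis
    by (cases m) (simp_all add: int_funpow_def nat_add_distrib funpow_Suc_right del: funpow.simps)
qed

lemma funpow_int_funpow:
  assumes "bij f"
  shows "(f ^^ N) (int_funpow f j x) = int_funpow f (j + int N) x"
proof (induction N)
  case (Suc N)
  thus ?case using int_funpow_Suc[OF assms, of "j + int N" x] by (simp add: add_ac)
qed simp

lemma int_funpow_dshift_const:
  assumes \<sigma>: "ring_map \<sigma>" "bij \<sigma>"
  shows "int_funpow (dshift \<sigma>) i (pconst c :: ('n, int, 'k::comm_ring_1) dpoly) =
    pconst (int_funpow \<sigma> i c)"
proof (cases "i \<ge> 0")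
  case True
  thus ?thesis by (simp add: int_funpow_def dshift_funpow_const[OF \<sigma>(1)])
next
  case False
  let ?s = "dshift \<sigma> :: ('n, int, 'k) dpoly \<Rightarrow> ('n, int, 'k) dpoly"
  note s = bij_dshift[OF \<sigma>, where ?'n = 'n]
  define n where "n = nat (- i)"
  have i: "i = - int n" using False by (simp add: n_def)
  (* Shifting both sides forward n = - i times turns each of them into pconst c. *)
  have "(?s ^^ n) (int_funpow ?s i (pconst c)) = (?s ^^ n) (pconst (int_funpow \<sigma> i c))"
    using funpow_int_funpow[OF s, of n i "pconst c"] funpow_int_funpow[OF \<sigma>(2), of n i c]
    by (simp add: dshift_funpow_const[OF \<sigma>(1)] i int_funpow_def)
  moreover have "inj (?s ^^ n)" using s by (simp add: bij_is_inj inj_fn)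
  ultimately show ?thesis by (rule injD[rotated])
qed

section \<open>Solutions and proper difference ideals\<close>

lemma ring_hom_seq_ring_iff:
  "\<phi> \<in> ring_hom ring_of_type_algebra seq_ring \<longleftrightarrow> (\<forall>i. ring_map (\<lambda>p. \<phi> p i))"
  by (auto simp: ring_hom_def ring_of_type_algebra_def seq_ring_def ring_map_def fun_eq_iff)

lemma seq_ring_simps [simp]: "carrier seq_ring = UNIV" "\<zero>\<^bsub>seq_ring\<^esub> = (\<lambda>_. 0)"
  by (simp_all add: seq_ring_def)

lemma is_solution_seq_ring_iff:
  "is_solution \<sigma> seq_ring s \<iota> F b \<longleftrightarrow>
    (\<exists>\<phi>. (\<forall>i. ring_map (\<lambda>p. \<phi> p i)) \<and> (\<forall>p. \<phi> (dshift \<sigma> p) = s (\<phi> p)) \<and>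
      (\<forall>c. \<phi> (dconst c) = \<iota> c) \<and> (\<forall>i. \<phi> (dvar i 0) = b i) \<and> (\<forall>f\<in>F. \<phi> f = (\<lambda>_. 0)))"
  unfolding is_solution_def Bex_def ring_hom_seq_ring_iff by simp

lemma N_solvable_of_Z_solvable:
  assumes "solvable_in_Z_sequences \<sigma> F"
  shows "solvable_in_N_sequences \<sigma> F"
proof -
  from assms obtain b \<phi> where \<phi>:
    "\<And>i. ring_map (\<lambda>p. \<phi> p i)" "\<And>p. \<phi> (dshift \<sigma> p) = seq_shift (\<phi> p)"
    "\<And>c. \<phi> (dconst c) = (\<lambda>i::int. int_funpow \<sigma> i c)"
    "\<And>i. \<phi> (dvar i 0) = b i" "\<And>f. f \<in> F \<Longrightarrow> \<phi> f = (\<lambda>_. 0)"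
    unfolding solvable_in_Z_sequences_def is_solution_seq_ring_iff
    by metis
  define \<phi>' where "\<phi>' p i = \<phi> p (int i)" for p i
  have "is_solution \<sigma> seq_ring seq_shift (\<lambda>c i. (\<sigma> ^^ i) c) F (\<lambda>i k. b i (int k))"
    unfolding is_solution_seq_ring_iff
    by (rule exI[of _ \<phi>']) (simp add: \<phi>'_def \<phi> seq_shift_def fun_eq_iff add.commute)
  thus ?thesis unfolding solvable_in_N_sequences_def by blast
qed

lemma dorder_le_max_order:
  "finite F \<Longrightarrow> f \<in> F \<Longrightarrow> dorder f \<le> max_order F"
  unfolding max_order_def by (intro Max_ge) auto

lemma index_le_dorder:
  assumes "m \<in> Poly_Mapping.keys f" "(i, j) \<in> Poly_Mapping.keys m"
  shows "j \<le> dorder f"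
proof -
  have "{j. \<exists>i. \<exists>m\<in>Poly_Mapping.keys f. (i, j) \<in> Poly_Mapping.keys m} =
    snd ` (\<Union>m\<in>Poly_Mapping.keys f. Poly_Mapping.keys m)"
    by force
  hence "finite {j. \<exists>i. \<exists>m\<in>Poly_Mapping.keys f. (i, j) \<in> Poly_Mapping.keys m}"
    by simp
  thus ?thesis unfolding dorder_def using assms by (intro Max_ge) auto
qed

text \<open>Entry \<open>s\<close> of \<open>\<phi> f\<close> is the value of the \<open>s\<close>-th shift of \<open>f\<close> at the array of all entries of the
  solution, so that array is a zero of all shifts of \<open>F\<close>. For \<open>s < l\<close> only the first \<open>l + max_order F\<close>
  columns are read.\<close>
lemma partial_solution_of_N_solvable:
  assumes \<sigma>: "ring_map \<sigma>" and "finite F" and "solvable_in_N_sequences \<sigma> F"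
  shows "\<exists>a. is_partial_solution \<sigma> F l a"
proof -
  from assms(3) obtain b \<phi> where \<phi>:
    "\<And>i. ring_map (\<lambda>p. \<phi> p i)" "\<And>p. \<phi> (dshift \<sigma> p) = seq_shift (\<phi> p)"
    "\<And>c. \<phi> (dconst c) = (\<lambda>i::nat. (\<sigma> ^^ i) c)"
    "\<And>i. \<phi> (dvar i 0) = b i" "\<And>f. f \<in> F \<Longrightarrow> \<phi> f = (\<lambda>_. 0)"
    unfolding solvable_in_N_sequences_def is_solution_seq_ring_iff
    by metis
  define \<beta> where "\<beta> = (\<lambda>(i, j). b i j)"
  have shift: "\<phi> ((dshift \<sigma> ^^ s) p) k = \<phi> p (k + s)" for s p k
    by (induction s arbitrary: k) (simp_all add: \<phi> seq_shift_def)
  have eval: "\<phi> p 0 = dsubst \<beta> p" for p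
  proof (rule ring_map_eqI[of "\<lambda>p. \<phi> p 0"])
    show "\<phi> (pvar v) 0 = dsubst \<beta> (pvar v)" for v
    proof (cases v)
      case (Pair i j)
      have "pvar (i, j) = (dshift \<sigma> ^^ j) (pvar (i, 0))"
        using dshift_funpow_var[OF \<sigma>, of j i "0::nat"] by simp
      hence "\<phi> (pvar (i, j)) 0 = \<phi> (pvar (i, 0)) j"
        using shift[of j "pvar (i, 0)" 0] by simp
      also have "\<dots> = b i j" using \<phi>(4)[of i] unfolding dvar_eq by simp
      finally show ?thesis by (simp add: Pair \<beta>_def dsubst_var[simplified])
    qed
  qed (use \<phi>(1,3) in \<open>simp_all add: ring_map_dsubst dconst_eq\<close>)
  define a where "a i = map (b i) [0..<l + max_order F]" for i
  have "is_partial_solution \<sigma> F l a"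
    unfolding is_partial_solution_def
  proof (intro conjI allI ballI impI)
    show "length (a j) = l + max_order F" for j by (simp add: a_def)
    fix f s assume f: "f \<in> F" and s: "s < l"
    have "a i ! (j + s) = b i (j + s)"
      if "m \<in> Poly_Mapping.keys f" "(i, j) \<in> Poly_Mapping.keys m" for m i j
      using index_le_dorder[OF that] dorder_le_max_order[OF \<open>finite F\<close> f] s
      by (simp add: a_def)
    hence "dsubst (\<lambda>(j, i). a j ! i) ((dshift \<sigma> ^^ s) f) = dsubst \<beta> ((dshift \<sigma> ^^ s) f)"
      unfolding dsubst_dshift_funpow[OF \<sigma>] poly_eval_def \<beta>_def
      by (intro sum.cong prod.cong refl arg_cong2[where f = "(*)"]) (auto split: prod.split)
    also have "\<dots> = 0" by (simp flip: eval add: shift \<phi> f)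
    finally show "dsubst (\<lambda>(j, i). a j ! i) ((dshift \<sigma> ^^ s) f) = 0" .
  qed
  thus ?thesis by blast
qed

lemma ring_ideal_diff_ideal: "ring_ideal (diff_ideal \<sigma> F)"
  unfolding diff_ideal_def by (rule ring_ideal_Idl)

lemma ring_ideal_diff_ideal_star: "ring_ideal (diff_ideal_star \<sigma> F)"
  unfolding diff_ideal_star_def by (rule ring_ideal_Idl)

lemma diff_ideal_subset_iff:
  "ring_ideal I \<Longrightarrow> diff_ideal \<sigma> F \<subseteq> I \<longleftrightarrow> (\<forall>f\<in>F. \<forall>j. (dshift \<sigma> ^^ j) f \<in> I)"
  unfolding diff_ideal_def by (subst Idl_subset_iff) auto

lemma diff_ideal_star_subset_iff:
  "ring_ideal I \<Longrightarrow>
    diff_ideal_star \<sigma> F \<subseteq> I \<longleftrightarrow> (\<forall>f\<in>F. \<forall>j. int_funpow (dshift \<sigma>) j (dembed f) \<in> I)"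
  unfolding diff_ideal_star_def by (subst Idl_subset_iff) auto

lemma dshift_diff_ideal:
  assumes "ring_map \<sigma>" "p \<in> diff_ideal \<sigma> F"
  shows "dshift \<sigma> p \<in> diff_ideal \<sigma> F"
proof -
  have gen: "(dshift \<sigma> ^^ j) f \<in> diff_ideal \<sigma> F" if "f \<in> F" for f j
    using that diff_ideal_subset_iff[OF ring_ideal_diff_ideal, of \<sigma> F \<sigma> F] by blast
  have "dshift \<sigma> ((dshift \<sigma> ^^ j) f) \<in> diff_ideal \<sigma> F" if "f \<in> F" for f j
    using gen[OF that, of "Suc j"] by simp
  hence "diff_ideal \<sigma> F \<subseteq> {p. dshift \<sigma> p \<in> diff_ideal \<sigma> F}"
    by (subst diff_ideal_subset_iff)
       (auto intro: ring_ideal_vimage ring_map_dshift ring_ideal_diff_ideal assms(1))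
  with assms(2) show ?thesis by blast
qed

text \<open>The polynomials that vanish on every zero of the first \<open>l\<close> shifts of \<open>F\<close>, for all large \<open>l\<close>, form an
  ideal which contains every shift of \<open>F\<close>. It does not contain \<open>1\<close> because such zeros exist. Partial
  solutions are used here as total assignments, with arbitrary values beyond the end of the lists.\<close>
lemma proper_diff_ideal_of_partial_solutions:
  fixes F :: "('n, nat, 'k::comm_ring_1) dpoly set"
  assumes "\<And>l. l \<ge> L \<Longrightarrow> \<exists>a. is_partial_solution \<sigma> F l a"
  shows "1 \<notin> diff_ideal \<sigma> F"
proof
  let ?V = "\<lambda>l. {\<alpha>. \<forall>f\<in>F. \<forall>s<l. dsubst \<alpha> ((dshift \<sigma> ^^ s) f) = 0}"
  let ?I = "{p. \<forall>\<^sub>F l in sequentially. \<forall>\<alpha>\<in>?V l. dsubst \<alpha> p = 0}"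
  have "ring_ideal ?I"
  proof (rule mult_module.subspaceI)
    show "0 \<in> ?I" by (simp add: ring_map_zero[OF ring_map_dsubst])
    show "x + y \<in> ?I" if "x \<in> ?I" "y \<in> ?I" for x y
      using that unfolding mem_Collect_eq
      by eventually_elim (simp add: ring_map_add[OF ring_map_dsubst])
    show "c * x \<in> ?I" if "x \<in> ?I" for c x
      using that unfolding mem_Collect_eq
      by eventually_elim (simp add: ring_map_mult[OF ring_map_dsubst])
  qed
  hence "diff_ideal \<sigma> F \<subseteq> ?I"
    by (subst diff_ideal_subset_iff) (auto intro: eventually_mono[OF eventually_gt_at_top])
  moreover assume "1 \<in> diff_ideal \<sigma> F"
  ultimately have "\<forall>\<^sub>F l in sequentially. \<forall>\<alpha>\<in>?V l. (1::'k) = 0"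
    by (auto simp: ring_map_one[OF ring_map_dsubst])
  with eventually_ge_at_top[of L] have "\<forall>\<^sub>F l in sequentially. False"
  proof eventually_elim
    case (elim l)
    from assms[OF elim(1)] obtain a where "is_partial_solution \<sigma> F l a" by blast
    hence "(\<lambda>(j, i). a j ! i) \<in> ?V l" by (simp add: is_partial_solution_def)
    with elim(2) show False by auto
  qed
  thus False by simp
qed

text \<open>A polynomial contains finitely many indeterminates, so shifting it far enough leaves no negative
  index.\<close>
lemma eventually_shift_in_dembed_range:
  fixes r :: "('n, int, 'k::comm_ring_1) dpoly"
  assumes "ring_map \<sigma>"
  shows "\<forall>\<^sub>F N in sequentially. (dshift \<sigma> ^^ N) r \<in> range dembed"
proof (induction r rule: polynomial_induct)
  case (const c)
  have "(dshift \<sigma> ^^ N) (pconst c) = dembed (pconst ((\<sigma> ^^ N) c))" for N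
    by (simp add: dshift_funpow_const[OF assms] dembed_const)
  hence "(dshift \<sigma> ^^ N) (pconst c) \<in> range dembed" for N by (rule range_eqI)
  thus ?case by (intro always_eventually allI)
next
  case (var v)
  obtain i j where v: "v = (i, j)" by (cases v)
  show ?case using eventually_ge_at_top[of "nat (- j)"]
  proof eventually_elim
    case (elim N)
    hence "j + int N = int (nat (j + int N))" by simp
    hence "(dshift \<sigma> ^^ N) (pvar v) = dembed (pvar (i, nat (j + int N)))"
      unfolding v dshift_funpow_var[OF assms] dembed_var by simp
    thus ?case by blast
  qed
next
  case (add p q)
  thus ?case
    by eventually_elim
       (auto simp: ring_map_add[OF ring_map_funpow[OF ring_map_dshift[OF assms]]]
         simp flip: ring_map_add[OF ring_map_dembed])
next
  case (mult p q)
  thus ?case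
    by eventually_elim
       (auto simp: ring_map_mult[OF ring_map_funpow[OF ring_map_dshift[OF assms]]]
         simp flip: ring_map_mult[OF ring_map_dembed])
qed

text \<open>The elements of \<open>K{x\<^sub>1,\<dots>,x\<^sub>n}\<^sup>*\<close> that large shifts carry into \<open>[F]\<close> form an ideal containing all
  shifts of \<open>F\<close>. Since shifting fixes \<open>1\<close>, this ideal contains \<open>1\<close> only if \<open>[F]\<close> does.\<close>
lemma proper_diff_ideal_star_of_proper_diff_ideal:
  fixes F :: "('n, nat, 'k::comm_ring_1) dpoly set"
  assumes \<sigma>: "ring_map \<sigma>" "bij \<sigma>" and "1 \<notin> diff_ideal \<sigma> F"
  shows "1 \<notin> diff_ideal_star \<sigma> F"
proof
  let ?s = "dshift \<sigma> :: ('n, int, 'k) dpoly \<Rightarrow> ('n, int, 'k) dpoly"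
  let ?J = "{p. \<forall>\<^sub>F N in sequentially. (?s ^^ N) p \<in> dembed ` diff_ideal \<sigma> F}"
  have s: "ring_map (?s ^^ N)" for N by (intro ring_map_funpow ring_map_dshift \<sigma>)
  note I = ring_ideal_diff_ideal[of \<sigma> F]
  have "ring_ideal ?J"
  proof (rule mult_module.subspaceI)
    have "0 \<in> dembed ` diff_ideal \<sigma> F"
      using mult_module.subspace_0[OF I] ring_map_zero[OF ring_map_dembed] by force
    thus "0 \<in> ?J" by (simp add: ring_map_zero[OF s])
    show "x + y \<in> ?J" if "x \<in> ?J" "y \<in> ?J" for x y
      using that unfolding mem_Collect_eq
    proof eventually_elim
      case (elim N)
      thus ?case
        by (auto simp: ring_map_add[OF s] mult_module.subspace_add[OF I]
             simp flip: ring_map_add[OF ring_map_dembed])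
    qed
    show "r * x \<in> ?J" if "x \<in> ?J" for r x
      using that eventually_shift_in_dembed_range[OF \<sigma>(1), of r] unfolding mem_Collect_eq
    proof eventually_elim
      case (elim N)
      thus ?case
        by (auto simp: ring_map_mult[OF s] mult_module.subspace_scale[OF I]
             simp flip: ring_map_mult[OF ring_map_dembed])
    qed
  qed
  moreover have "int_funpow ?s j (dembed f) \<in> ?J" if f: "f \<in> F" for f j
    unfolding mem_Collect_eq using eventually_ge_at_top[of "nat (- j)"]
  proof eventually_elim
    case (elim N)
    hence "j + int N = int (nat (j + int N))" by simp
    hence "(?s ^^ N) (int_funpow ?s j (dembed f)) = (?s ^^ nat (j + int N)) (dembed f)"
      using funpow_int_funpow[OF bij_dshift[OF \<sigma>], of N j "dembed f"]
      by (metis int_funpow_of_nat)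
    also have "\<dots> = dembed ((dshift \<sigma> ^^ nat (j + int N)) f)"
      by (simp add: dembed_dshift_funpow[OF \<sigma>(1)])
    finally show ?case
      using f diff_ideal_subset_iff[OF I, of \<sigma> F] by auto
  qed
  ultimately have "diff_ideal_star \<sigma> F \<subseteq> ?J"
    by (subst diff_ideal_star_subset_iff) auto
  moreover assume "1 \<in> diff_ideal_star \<sigma> F"
  ultimately have "\<forall>\<^sub>F N::nat in sequentially. (1 :: ('n, int, 'k) dpoly) \<in> dembed ` diff_ideal \<sigma> F"
    by (auto simp: ring_map_one[OF s])
  hence "dembed 1 \<in> dembed ` diff_ideal \<sigma> F"
    by (simp add: ring_map_one[OF ring_map_dembed])
  with assms(3) inj_image_mem_iff[OF inj_dembed, of 1 "diff_ideal \<sigma> F"] show False by simp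
qed

text \<open>A zero \<open>\<alpha>\<close> of \<open>[F]\<^sup>*\<close> defines the solution: entry \<open>k\<close> of the image of \<open>p\<close> is the value at \<open>\<alpha>\<close> of the
  \<open>k\<close>-th shift of \<open>p\<close>, which makes the map commute with shifts by construction.\<close>
lemma Z_solvable_of_proper_diff_ideal_star:
  fixes F :: "('n::finite, nat, 'k::alg_closed_field) dpoly set"
  assumes unc: "uncountable (UNIV :: 'k set)"
    and \<sigma>: "ring_map \<sigma>" "bij \<sigma>" and "1 \<notin> diff_ideal_star \<sigma> F"
  shows "solvable_in_Z_sequences \<sigma> F"
proof -
  have "countable (UNIV :: ('n \<times> int) set)" by (rule countableI_type)
  from countable_nullstellensatz[OF this unc ring_ideal_diff_ideal_star assms(4)]
  obtain \<alpha> where \<alpha>: "\<And>p. p \<in> diff_ideal_star \<sigma> F \<Longrightarrow> dsubst \<alpha> p = 0"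
    unfolding dsubst_eq_poly_eval by blast
  let ?s = "dshift \<sigma> :: ('n, int, 'k) dpoly \<Rightarrow> ('n, int, 'k) dpoly"
  note s = bij_dshift[OF \<sigma>, where ?'n = 'n]
  define \<phi> where "\<phi> p k = dsubst \<alpha> (int_funpow ?s k (dembed p))" for p k
  have "is_solution \<sigma> seq_ring seq_shift (\<lambda>c i. int_funpow \<sigma> i c) F (\<lambda>i. \<phi> (dvar i 0))"
    unfolding is_solution_seq_ring_iff
  proof (intro exI[of _ \<phi>] conjI allI ballI refl)
    show "ring_map (\<lambda>p. \<phi> p i)" for i
      unfolding \<phi>_def
      by (intro ring_map_comp[OF ring_map_dsubst] ring_map_comp[OF ring_map_int_funpow]
          ring_map_dembed ring_map_dshift \<sigma> s)
    show "\<phi> (dshift \<sigma> p) = seq_shift (\<phi> p)" for p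
      by (simp add: \<phi>_def seq_shift_def dembed_dshift \<sigma> int_funpow_Suc'[OF s] fun_eq_iff)
    show "\<phi> (dconst c) = (\<lambda>i. int_funpow \<sigma> i c)" for c
    proof
      fix i
      show "\<phi> (dconst c) i = int_funpow \<sigma> i c"
        by (simp add: \<phi>_def dconst_eq dembed_const int_funpow_dshift_const[OF \<sigma>])
    qed
    show "\<phi> f = (\<lambda>_. 0)" if "f \<in> F" for f
      using that diff_ideal_star_subset_iff[OF ring_ideal_diff_ideal_star, of \<sigma> F \<sigma> F]
      by (auto simp: \<phi>_def fun_eq_iff intro!: \<alpha>)
  qed
  thus ?thesis unfolding solvable_in_Z_sequences_def by blast
qed

text \<open>The kernel of the evaluation map is an ideal containing all shifts of \<open>F\<close>. It omits \<open>1\<close>, since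
  otherwise \<open>1 = 0\<close> in the algebra, against injectivity of the structure map.\<close>
lemma proper_diff_ideal_of_solvable_in_algebra:
  fixes F :: "('n, nat, 'k::field) dpoly set"
  assumes "solvable_in_algebra TYPE('b) \<sigma> F"
  shows "1 \<notin> diff_ideal \<sigma> F"
proof
  from assms obtain B :: "'b ring" and s \<iota> b \<phi> where
    alg: "difference_algebra (ring_of_type_algebra :: 'k ring) \<sigma> B s \<iota>"
    and \<phi>: "\<phi> \<in> ring_hom (ring_of_type_algebra :: ('n, nat, 'k) dpoly ring) B"
      "\<And>p. \<phi> (dshift \<sigma> p) = s (\<phi> p)" "\<And>f. f \<in> F \<Longrightarrow> \<phi> f = \<zero>\<^bsub>B\<^esub>"
    unfolding solvable_in_algebra_def is_solution_def by blast
  interpret B: cring B using alg by (simp add: difference_algebra_def difference_ring_def)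
  have s: "s \<in> ring_hom B B" and \<iota>: "\<iota> \<in> ring_hom (ring_of_type_algebra :: 'k ring) B" "inj \<iota>"
    using alg by (simp_all add: difference_algebra_def difference_ring_def ring_of_type_algebra_def)
  have zero: "\<phi> 0 = \<zero>\<^bsub>B\<^esub>" "\<iota> 0 = \<zero>\<^bsub>B\<^esub>" "s \<zero>\<^bsub>B\<^esub> = \<zero>\<^bsub>B\<^esub>"
    using ring_hom_zero[OF \<phi>(1) ring_from_type_algebra B.ring_axioms]
      ring_hom_zero[OF \<iota>(1) ring_from_type_algebra B.ring_axioms]
      ring_hom_zero[OF s B.ring_axioms B.ring_axioms]
    by (simp_all add: ring_of_type_algebra_def)
  have hom: "\<phi> (x + y) = \<phi> x \<oplus>\<^bsub>B\<^esub> \<phi> y" "\<phi> (x * y) = \<phi> x \<otimes>\<^bsub>B\<^esub> \<phi> y" "\<phi> x \<in> carrier B"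
    "\<phi> 1 = \<one>\<^bsub>B\<^esub>" "\<iota> 1 = \<one>\<^bsub>B\<^esub>" for x y
    using \<phi>(1) \<iota>(1) by (auto simp: ring_hom_def ring_of_type_algebra_def)
  have "ring_ideal {p. \<phi> p = \<zero>\<^bsub>B\<^esub>}"
    by (rule mult_module.subspaceI) (simp_all add: zero hom)
  moreover have "\<phi> ((dshift \<sigma> ^^ j) f) = \<zero>\<^bsub>B\<^esub>" if "f \<in> F" for f j
    using that by (induction j) (simp_all add: \<phi> zero)
  ultimately have "diff_ideal \<sigma> F \<subseteq> {p. \<phi> p = \<zero>\<^bsub>B\<^esub>}"
    by (subst diff_ideal_subset_iff) auto
  moreover assume "1 \<in> diff_ideal \<sigma> F"
  ultimately have "\<iota> 1 = \<iota> 0" using hom zero by auto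
  with \<iota>(2) show False by (simp add: inj_eq)
qed

text \<open>The quotient by \<open>[F]\<close> with the residue classes of the \<open>x\<^sub>i\<close> is a solution; the shift descends to the
  quotient because \<open>[F]\<close> is stable under it.\<close>
lemma solvable_in_quotient_of_proper_diff_ideal:
  fixes F :: "('n, nat, 'k::field) dpoly set"
  assumes \<sigma>: "ring_map \<sigma>" and proper: "1 \<notin> diff_ideal \<sigma> F"
  shows "solvable_in_algebra TYPE(('n, nat, 'k) dpoly set) \<sigma> F"
proof -
  define I where "I = diff_ideal \<sigma> F"
  let ?R = "ring_of_type_algebra :: ('n, nat, 'k) dpoly ring"
  let ?B = "?R Quot I"
  have I: "ring_ideal I" unfolding I_def by (rule ring_ideal_diff_ideal)
  interpret R: cring ?R by (rule cring_from_type_algebra)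
  interpret I: ideal I ?R using I by (simp add: ideal_ring_of_type_algebra_iff)
  define Q where "Q p = I +>\<^bsub>?R\<^esub> p" for p
  have Q_eq: "Q p = {q. q - p \<in> I}" for p
    by (force simp: Q_def a_r_coset_def' ring_of_type_algebra_def)
  have Q_iff: "Q p = Q q \<longleftrightarrow> p - q \<in> I" for p q
  proof
    assume "Q p = Q q"
    moreover have "p \<in> Q p" by (simp add: Q_eq mult_module.subspace_0[OF I])
    ultimately show "p - q \<in> I" by (simp add: Q_eq)
  next
    assume pq: "p - q \<in> I"
    have "r - p \<in> I \<longleftrightarrow> r - q \<in> I" for r
      using mult_module.subspace_add[OF I pq, of "r - p"]
        mult_module.subspace_diff[OF I _ pq, of "r - q"] by auto
    thus "Q p = Q q" by (simp add: Q_eq)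
  qed
  have Q_hom: "Q \<in> ring_hom ?R ?B" unfolding Q_def by (rule I.rcos_ring_hom)
  have carrier: "carrier ?B = range Q"
    by (auto simp: FactRing_def A_RCOSETS_def' Q_def ring_of_type_algebra_def a_r_coset_def')
  have hom: "Q (p + q) = Q p \<oplus>\<^bsub>?B\<^esub> Q q" "Q (p * q) = Q p \<otimes>\<^bsub>?B\<^esub> Q q" "Q 1 = \<one>\<^bsub>?B\<^esub>" for p q
    using Q_hom by (auto simp: ring_hom_def ring_of_type_algebra_def)
  have zero: "Q 0 = \<zero>\<^bsub>?B\<^esub>"
    by (simp add: Q_eq FactRing_def)
  (* All members q of a coset C yield the same coset of dshift \<sigma> q, so the union is that coset. *)
  define s where "s C = (\<Union>q\<in>C. Q (dshift \<sigma> q))" for C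
  have s: "s (Q p) = Q (dshift \<sigma> p)" for p
  proof -
    have "Q (dshift \<sigma> q) = Q (dshift \<sigma> p)" if "q \<in> Q p" for q
      unfolding Q_iff using that dshift_diff_ideal[OF \<sigma>, of "q - p" F]
      by (simp add: Q_eq I_def ring_map_diff[OF ring_map_dshift[OF \<sigma>]])
    moreover have "p \<in> Q p" by (simp add: Q_eq mult_module.subspace_0[OF I])
    ultimately show ?thesis unfolding s_def by blast
  qed
  have "s \<in> ring_hom ?B ?B"
    by (rule ring_hom_memI)
       (auto simp: carrier s simp flip: hom,
        simp_all add: s ring_map_add[OF ring_map_dshift[OF \<sigma>]] ring_map_mult[OF ring_map_dshift[OF \<sigma>]]
          ring_map_one[OF ring_map_dshift[OF \<sigma>]])
  moreover have "inj (\<lambda>c. Q (pconst c))"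
  proof (rule injI, rule ccontr)
    fix c d :: 'k assume "Q (pconst c) = Q (pconst d)" and ne: "c \<noteq> d"
    hence "pconst (c - d) \<in> I" by (simp add: Q_iff single_diff)
    from mult_module.subspace_scale[OF I this, of "pconst (inverse (c - d))"] ne proper
    show False by (simp add: mult_single I_def)
  qed
  moreover have "(\<lambda>c. Q (pconst c)) \<in> ring_hom (ring_of_type_algebra :: 'k ring) ?B"
    by (rule ring_hom_memI)
       (simp_all add: carrier ring_of_type_algebra_def[where 'a = 'k] single_add
         mult_single[of 0 _ 0, simplified, symmetric] flip: hom)
  ultimately have alg: "difference_algebra (ring_of_type_algebra :: 'k ring) \<sigma> ?B s (\<lambda>c. Q (pconst c))"
    unfolding difference_algebra_def difference_ring_def
    using I.quotient_is_cring[OF R.cring_axioms]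
    by (auto simp: s dshift_const[OF \<sigma>] inj_on_def)
  have "Q f = \<zero>\<^bsub>?B\<^esub>" if "f \<in> F" for f
  proof -
    have "(dshift \<sigma> ^^ 0) f \<in> I"
      using that diff_ideal_subset_iff[OF I, of \<sigma> F] unfolding I_def by blast
    thus ?thesis by (simp add: Q_iff flip: zero)
  qed
  hence "is_solution \<sigma> ?B s (\<lambda>c. Q (pconst c)) F (\<lambda>i. Q (dvar i 0))"
    unfolding is_solution_def
    by (intro conjI bexI[of _ Q] Q_hom) (auto simp: carrier s dconst_eq)
  with alg show ?thesis unfolding solvable_in_algebra_def by blast
qed

theorem proposition6p3:
  fixes \<sigma> :: "'k::alg_closed_field \<Rightarrow> 'k"
    and F :: "('n::finite, nat, 'k) dpoly set"
  assumes "uncountable (UNIV :: 'k set)"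
    and "inversive_difference_field (ring_of_type_algebra :: 'k ring) \<sigma>"
    and "finite F"
  shows
    "(solvable_in_Z_sequences \<sigma> F \<longleftrightarrow> solvable_in_N_sequences \<sigma> F) \<and>
     (solvable_in_N_sequences \<sigma> F \<longleftrightarrow>
        (\<exists>L. \<forall>l\<ge>L. \<exists>a. is_partial_solution \<sigma> F l a)) \<and>
     ((\<exists>L. \<forall>l\<ge>L. \<exists>a. is_partial_solution \<sigma> F l a) \<longleftrightarrow> 1 \<notin> diff_ideal \<sigma> F) \<and>
     (1 \<notin> diff_ideal \<sigma> F \<longleftrightarrow> 1 \<notin> diff_ideal_star \<sigma> F) \<and>
     (1 \<notin> diff_ideal_star \<sigma> F \<longleftrightarrow>
        solvable_in_algebra TYPE(('n, nat, 'k) dpoly set) \<sigma> F) \<and>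
     (solvable_in_algebra TYPE('b) \<sigma> F \<longrightarrow>
        solvable_in_algebra TYPE(('n, nat, 'k) dpoly set) \<sigma> F)"
proof -
  have \<sigma>: "ring_map \<sigma>" "bij \<sigma>"
    using assms(2)
    by (auto simp: ring_map_iff_ring_hom inversive_difference_field_def
        inversive_difference_ring_def difference_ring_def ring_of_type_algebra_def)
  have 1: "solvable_in_Z_sequences \<sigma> F \<Longrightarrow> solvable_in_N_sequences \<sigma> F"
    by (rule N_solvable_of_Z_solvable)
  have 2: "solvable_in_N_sequences \<sigma> F \<Longrightarrow> \<exists>L. \<forall>l\<ge>L. \<exists>a. is_partial_solution \<sigma> F l a"
    using partial_solution_of_N_solvable[OF \<sigma>(1) assms(3)] by blast
  have 3: "\<exists>L. \<forall>l\<ge>L. \<exists>a. is_partial_solution \<sigma> F l a \<Longrightarrow> 1 \<notin> diff_ideal \<sigma> F"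
    using proper_diff_ideal_of_partial_solutions by blast
  have 4: "1 \<notin> diff_ideal \<sigma> F \<Longrightarrow> 1 \<notin> diff_ideal_star \<sigma> F"
    by (rule proper_diff_ideal_star_of_proper_diff_ideal[OF \<sigma>])
  have 5: "1 \<notin> diff_ideal_star \<sigma> F \<Longrightarrow> solvable_in_Z_sequences \<sigma> F"
    by (rule Z_solvable_of_proper_diff_ideal_star[OF assms(1) \<sigma>])
  have 6: "1 \<notin> diff_ideal \<sigma> F \<Longrightarrow> solvable_in_algebra TYPE(('n, nat, 'k) dpoly set) \<sigma> F"
    by (rule solvable_in_quotient_of_proper_diff_ideal[OF \<sigma>(1)])
  show ?thesis
    using 1 2 3 4 5 6 proper_diff_ideal_of_solvable_in_algebra[of \<sigma> F, where 'b = 'b]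
      proper_diff_ideal_of_solvable_in_algebra[of \<sigma> F, where 'b = "('n, nat, 'k) dpoly set"]
    by argo
qed

end
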